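(* Let $f$ be a discrete Morse-Bott function on a Lefschetz complex $\mathbb{K}$, and carry out the block reduction construction (described in the context) starting from $(\mathbb{K},f)$, with any choices. Then for every $k\in\mathbb{Z}_{\ge0}$: (1) the coefficient of $t^k$ in $R_t(\mathbb{K},f)$ equals the number of elementary blocks $E(\mu,\kappa)$ with $\dim\mu=k+1$ produced by Move (IV) in the construction; (2) the Betti number $b_k^{\mathbb{K}}$ equals the number of $k$-cells removed by Move (II) in the construction. In particular, the coefficients of $R_t(\mathbb{K},f)$ are nonnegative integers, and both counts are independent of the choices made in the construction.
   Context: A Lefschetz complex is a triple $\mathbb{K}=(X,\dim,w)$, where $X$ is a set (of cells), $\dim\colon X\to\mathbb{Z}_{\ge0}$ and $w\colon X\times X\to\mathbb{R}$ are functions, $\dim^{-1}(k)$ is finite for every $k$, and: (L1) $w(\tau,\sigma)\neq0$ implies $\dim\tau-\dim\sigma=1$; (L2) $\sum_{\sigma\in X}w(\tau,\sigma)w(\sigma,\nu)=0$ for all $\tau,\nu\in X$. A cell of dimension $k$ is a $k$-cell. In a disjoint union $\sqcup$ of Lefschetz complexes, incidence numbers between cells of distinct summands are $0$. Functions on a complex are restricted to complexes with smaller cell set without change of notation. $C_k(\mathbb{K})$ is the real vector space with basis the $k$-cells, $C_{-1}(\mathbb{K})=\{0\}$, $\partial_k(\tau)=\sum_\sigma w(\tau,\sigma)\sigma$ for a $k$-cell $\tau$ (sum over $(k-1)$-cells), $B_k(\mathbb{K})=\operatorname{im}\partial_{k+1}$, $b_k^{\mathbb{K}}=\operatorname{rank}(\ker\partial_k/B_k(\mathbb{K}))$.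 For $f\colon\mathbb{K}\to\mathbb{R}$ put $U^{\mathrm{snc}}(\sigma)=\#\{\tau\mid w(\tau,\sigma)\ne0,\ f(\sigma)>f(\tau)\}$, $D^{\mathrm{snc}}(\sigma)=\#\{\nu\mid w(\sigma,\nu)\ne0,\ f(\sigma)<f(\nu)\}$. $f$ is discrete Morse-Bott if $U^{\mathrm{snc}}(\sigma)\le1$ and $D^{\mathrm{snc}}(\sigma)\le1$ for all $\sigma$. A cell $\sigma$ is weakly critical if $U^{\mathrm{snc}}(\sigma)+D^{\mathrm{snc}}(\sigma)=0$. $\mathbb{W}(\mathbb{K},f)$ is the Lefschetz complex whose cells are the weakly critical cells, with restricted dimension function and incidence function $w(\tau,\sigma)$ if $f(\tau)=f(\sigma)$ and $0$ otherwise. With $d_k^{\mathrm{snc}}(\mathbb{K},f)=\#\{k\text{-cells }\sigma\mid D^{\mathrm{snc}}(\sigma)=1\}$, $$R_t(\mathbb{K},f)=\sum_{k=1}^\infty\bigl(\operatorname{rank}B_{k-1}(\mathbb{K})-d_k^{\mathrm{snc}}(\mathbb{K},f)-\operatorname{rank}B_{k-1}(\mathbb{W}(\mathbb{K},f))\bigr)t^{k-1}.$$ For cells with $w(\mu,\kappa)\ne0$, $\mathbb{K}\{\mu,\kappa\}$ is the Lefschetz complex with cell set $X\setminus\{\mu,\kappa\}$, restricted dimension function, and incidence function $w'(\tau,\sigma)=w(\tau,\sigma)-w(\tau,\kappa)w(\mu,\sigma)/w(\mu,\kappa)$. For $\dim\mu-\dim\kappa=1$, the elementary block $E(\mu,\kappa)$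 is the Lefschetz complex with cells $\mu,\kappa$, incidence number $1$ at $(\mu,\kappa)$ and $0$ otherwise. A cell $\eta$ is isolated if $w(\sigma,\eta)=w(\eta,\sigma)=0$ for all $\sigma$. Stage $n$ of the construction. Input: a Lefschetz complex $\mathbb{M}$ all of whose cells have dimension $\ge n$, and a discrete Morse-Bott function $g$ on $\mathbb{M}$. All notions refer to the current complex and function. Step 1 (Move (I), case (a)). For $j=n,n+1,n+2$ in this order: as long as there is a $j$-cell $\sigma$ with $U^{\mathrm{snc}}(\sigma)=1$, choose one, let $\tau$ be the unique cell counted in $U^{\mathrm{snc}}(\sigma)$, and replace the complex $\mathbb{L}$ at hand by $\mathbb{L}\{\tau,\sigma\}$. (At the end all cells of dimension at most $n+2$ are weakly critical.) Step 2 (Move (I), case (b)). As long as there is a pair of cells $\tau,\sigma$ with nonzero incidence number at $(\tau,\sigma)$, $g(\tau)=g(\sigma)$, and $(\dim\tau,\dim\sigma)\in\{(n+2,n+1),(n+1,n)\}$, choose one and replace $\mathbb{L}$ by $\mathbb{L}\{\tau,\sigma\}$. Step 3 (Move (III)). Put $c=(n+2)-\min\{g(\tau')\mid\dim\tau'=n+2\}$ if there are $(n+2)$-cells and $c=0$ otherwise; replace $g$ by $g'$, where $g'(\sigma)=\dim\sigma$ if $\dim\sigma\le n+1$ and $g'(\sigma)=g(\sigma)+c$ if $\dim\sigma\ge n+2$. Step 4 (Move (IV)). Let $\widetilde{\mathbb{M}}$ be the complex obtained. As long as there are an $n$-cell $\kappa$ and an $(n+1)$-cell $\mu$ of $\widetilde{\mathbb{M}}$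 with nonzero incidence number at $(\mu,\kappa)$, choose such a pair, replace the summand $\widetilde{\mathbb{M}}$ by $\widetilde{\mathbb{M}}\{\mu,\kappa\}\sqcup E(\mu,\kappa)$, set the elementary block $E(\mu,\kappa)$ (produced by this Move (IV)) aside, and continue with $\widetilde{\mathbb{M}}\{\mu,\kappa\}$ in place of $\widetilde{\mathbb{M}}$. Step 5 (Move (II)). Every $n$-cell of the remaining $\widetilde{\mathbb{M}}$ is now isolated in it; remove all of them, one at a time (each removal is an application of Move (II)). Output: $\mathbb{E}$, the disjoint union of the elementary blocks set aside; $\mathbb{M}'$, the remaining complex (all of whose cells have dimension $\ge n+1$); and the discrete Morse-Bott function $g'$ on $\mathbb{M}'$. Every step terminates. Block reduction construction: put $\mathbb{E}_0=\emptyset$, $\mathbb{M}_0=\mathbb{K}$, $f_0=f$; for $n=0,1,2,\dots$ apply stage $n$ to $(\mathbb{M}_n,f_n)$, with output $\mathbb{E},\mathbb{M}',g'$, and put $\mathbb{E}_{n+1}=\mathbb{E}_n\sqcup\mathbb{E}$, $\mathbb{M}_{n+1}=\mathbb{M}'$, $f_{n+1}=g'$. *)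

theory Defs
  imports "HOL-Analysis.Analysis" "HOL-Analysis.Finite_Function_Topology"
    "HOL-Computational_Algebra.Formal_Power_Series"
begin

section \<open>Lefschetz complexes\<close>

text \<open>
  The functions of a complex are total on the type of cells; only their values on
  \<^term>\<open>cells K\<close> are meaningful, and every notion below looks at those values only.  Hence
  restricting a function to a smaller set of cells needs no change of the function.
\<close>

record 'a lefschetz =
  cells :: "'a set"
  cdim :: "'a \<Rightarrow> nat"
  inc :: "'a \<Rightarrow> 'a \<Rightarrow> real"

definition kcells :: "'a lefschetz \<Rightarrow> nat \<Rightarrow> 'a set" where
  "kcells K k = {\<sigma> \<in> cells K. cdim K \<sigma> = k}"

text \<open>
  The set of cells may be infinite.  The sum in the second incidence axiom is therefore taken over
  the cells with nonzero summand; by the first axiom and finiteness they form a finite set.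
\<close>

locale lefschetz_complex =
  fixes K :: "'a lefschetz"
  assumes finite_kcells: "finite (kcells K k)"
    and inc_dim: "\<lbrakk>\<tau> \<in> cells K; \<sigma> \<in> cells K; inc K \<tau> \<sigma> \<noteq> 0\<rbrakk>
          \<Longrightarrow> int (cdim K \<tau>) - int (cdim K \<sigma>) = 1"
    and inc_inc: "\<lbrakk>\<tau> \<in> cells K; \<nu> \<in> cells K\<rbrakk>
          \<Longrightarrow> (\<Sum>\<sigma> | \<sigma> \<in> cells K \<and> inc K \<tau> \<sigma> * inc K \<sigma> \<nu> \<noteq> 0. inc K \<tau> \<sigma> * inc K \<sigma> \<nu>) = 0"

definition empty_complex :: "'a lefschetz" where
  "empty_complex = \<lparr>cells = {}, cdim = (\<lambda>_. 0), inc = (\<lambda>_ _. 0)\<rparr>"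

text \<open>Only used when the two cell sets are disjoint.\<close>

definition disjoint_sum :: "'a lefschetz \<Rightarrow> 'a lefschetz \<Rightarrow> 'a lefschetz" where
  "disjoint_sum K L =
     \<lparr>cells = cells K \<union> cells L,
      cdim = (\<lambda>\<sigma>. if \<sigma> \<in> cells K then cdim K \<sigma> else cdim L \<sigma>),
      inc = (\<lambda>\<tau> \<sigma>. if \<tau> \<in> cells K \<and> \<sigma> \<in> cells K then inc K \<tau> \<sigma>
                   else if \<tau> \<in> cells L \<and> \<sigma> \<in> cells L then inc L \<tau> \<sigma> else 0)\<rparr>"

definition isolated :: "'a lefschetz \<Rightarrow> 'a \<Rightarrow> bool" where
  "isolated K \<eta> \<longleftrightarrow> (\<forall>\<sigma> \<in> cells K. inc K \<sigma> \<eta> = 0 \<and> inc K \<eta> \<sigma> = 0)"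

definition remove_cell :: "'a lefschetz \<Rightarrow> 'a \<Rightarrow> 'a lefschetz" where
  "remove_cell K \<eta> = K\<lparr>cells := cells K - {\<eta>}\<rparr>"

definition reduce_pair :: "'a lefschetz \<Rightarrow> 'a \<Rightarrow> 'a \<Rightarrow> 'a lefschetz" where
  "reduce_pair K \<mu> \<kappa> =
     K\<lparr>cells := cells K - {\<mu>, \<kappa>},
       inc := (\<lambda>\<tau> \<sigma>. inc K \<tau> \<sigma> - inc K \<tau> \<kappa> * inc K \<mu> \<sigma> / inc K \<mu> \<kappa>)\<rparr>"

definition elementary_block :: "('a \<Rightarrow> nat) \<Rightarrow> 'a \<Rightarrow> 'a \<Rightarrow> 'a lefschetz" where
  "elementary_block d \<mu> \<kappa> =
     \<lparr>cells = {\<mu>, \<kappa>}, cdim = d, inc = (\<lambda>\<tau> \<sigma>. if \<tau> = \<mu> \<and> \<sigma> = \<kappa> then 1 else 0)\<rparr>"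


section \<open>Chains and Betti numbers\<close>

text \<open>
  A chain is a finitely supported real function on cells, and the basis vector belonging to the
  cell \<open>\<sigma>\<close> is \<^term>\<open>Poly_Mapping.single \<sigma> (1::real)\<close>.
\<close>

definition chains :: "'a lefschetz \<Rightarrow> nat \<Rightarrow> ('a \<Rightarrow>\<^sub>0 real) set" where
  "chains K k = span ((\<lambda>\<sigma>. Poly_Mapping.single \<sigma> 1) ` kcells K k)"

text \<open>For a \<open>0\<close>-cell the sum is empty, in accordance with \<open>C\<^sub>-\<^sub>1 = 0\<close>.\<close>

definition cell_boundary :: "'a lefschetz \<Rightarrow> 'a \<Rightarrow> 'a \<Rightarrow>\<^sub>0 real" where
  "cell_boundary K \<tau> =
     (\<Sum>\<sigma> | \<sigma> \<in> cells K \<and> Suc (cdim K \<sigma>) = cdim K \<tau>. inc K \<tau> \<sigma> *\<^sub>R Poly_Mapping.single \<sigma> 1)"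

definition boundary :: "'a lefschetz \<Rightarrow> nat \<Rightarrow> ('a \<Rightarrow>\<^sub>0 real) \<Rightarrow> 'a \<Rightarrow>\<^sub>0 real" where
  "boundary K k c = (\<Sum>\<tau> \<in> kcells K k. Poly_Mapping.lookup c \<tau> *\<^sub>R cell_boundary K \<tau>)"

definition cycles :: "'a lefschetz \<Rightarrow> nat \<Rightarrow> ('a \<Rightarrow>\<^sub>0 real) set" where
  "cycles K k = {c \<in> chains K k. boundary K k c = 0}"

definition boundaries :: "'a lefschetz \<Rightarrow> nat \<Rightarrow> ('a \<Rightarrow>\<^sub>0 real) set" where
  "boundaries K k = boundary K (Suc k) ` chains K (Suc k)"

text \<open>
  \<open>quotient_basis V W B\<close> says that the cosets \<open>b + W\<close> for \<open>b \<in> B\<close> are pairwise distinct and form a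
  finite basis of the quotient space \<open>V / W\<close>: a linear combination of them is zero in \<open>V / W\<close> iff
  the corresponding combination of representatives lies in \<open>W\<close>.  The rank is the cardinality of
  any such basis, as for \<^const>\<open>dim\<close>.
\<close>

definition quotient_basis :: "'v::real_vector set \<Rightarrow> 'v set \<Rightarrow> 'v set \<Rightarrow> bool" where
  "quotient_basis V W B \<longleftrightarrow> finite B \<and> B \<subseteq> V \<and>
     (\<forall>a. (\<Sum>b\<in>B. a b *\<^sub>R b) \<in> W \<longrightarrow> (\<forall>b\<in>B. a b = 0)) \<and>
     (\<forall>v\<in>V. \<exists>a. v - (\<Sum>b\<in>B. a b *\<^sub>R b) \<in> W)"

definition quotient_rank :: "'v::real_vector set \<Rightarrow> 'v set \<Rightarrow> nat" where
  "quotient_rank V W = card (SOME B. quotient_basis V W B)"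

definition betti :: "'a lefschetz \<Rightarrow> nat \<Rightarrow> nat" where
  "betti K k = quotient_rank (cycles K k) (boundaries K k)"


section \<open>Discrete Morse-Bott functions\<close>

definition up_cells :: "'a lefschetz \<Rightarrow> ('a \<Rightarrow> real) \<Rightarrow> 'a \<Rightarrow> 'a set" where
  "up_cells K f \<sigma> = {\<tau> \<in> cells K. inc K \<tau> \<sigma> \<noteq> 0 \<and> f \<sigma> > f \<tau>}"

definition down_cells :: "'a lefschetz \<Rightarrow> ('a \<Rightarrow> real) \<Rightarrow> 'a \<Rightarrow> 'a set" where
  "down_cells K f \<sigma> = {\<nu> \<in> cells K. inc K \<sigma> \<nu> \<noteq> 0 \<and> f \<sigma> < f \<nu>}"

definition U_snc :: "'a lefschetz \<Rightarrow> ('a \<Rightarrow> real) \<Rightarrow> 'a \<Rightarrow> nat" where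
  "U_snc K f \<sigma> = card (up_cells K f \<sigma>)"

definition D_snc :: "'a lefschetz \<Rightarrow> ('a \<Rightarrow> real) \<Rightarrow> 'a \<Rightarrow> nat" where
  "D_snc K f \<sigma> = card (down_cells K f \<sigma>)"

definition discrete_morse_bott :: "'a lefschetz \<Rightarrow> ('a \<Rightarrow> real) \<Rightarrow> bool" where
  "discrete_morse_bott K f \<longleftrightarrow> (\<forall>\<sigma> \<in> cells K. U_snc K f \<sigma> \<le> 1 \<and> D_snc K f \<sigma> \<le> 1)"

definition weakly_critical :: "'a lefschetz \<Rightarrow> ('a \<Rightarrow> real) \<Rightarrow> 'a \<Rightarrow> bool" where
  "weakly_critical K f \<sigma> \<longleftrightarrow> \<sigma> \<in> cells K \<and> U_snc K f \<sigma> + D_snc K f \<sigma> = 0"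

definition weakly_critical_complex :: "'a lefschetz \<Rightarrow> ('a \<Rightarrow> real) \<Rightarrow> 'a lefschetz" where
  "weakly_critical_complex K f =
     \<lparr>cells = {\<sigma>. weakly_critical K f \<sigma>},
      cdim = cdim K,
      inc = (\<lambda>\<tau> \<sigma>. if f \<tau> = f \<sigma> then inc K \<tau> \<sigma> else 0)\<rparr>"

definition d_snc :: "'a lefschetz \<Rightarrow> ('a \<Rightarrow> real) \<Rightarrow> nat \<Rightarrow> nat" where
  "d_snc K f k = card {\<sigma> \<in> kcells K k. D_snc K f \<sigma> = 1}"

text \<open>
  The series \<open>\<Sum>k\<ge>1. (rank B\<^sub>k\<^sub>-\<^sub>1(K) - d\<^sub>k - rank B\<^sub>k\<^sub>-\<^sub>1(W)) t\<^sup>k\<^sup>-\<^sup>1\<close>, reindexed by \<open>i = k - 1\<close>.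
\<close>

definition R_series :: "'a lefschetz \<Rightarrow> ('a \<Rightarrow> real) \<Rightarrow> real fps" where
  "R_series K f = Abs_fps (\<lambda>i. real (dim (boundaries K i)) - real (d_snc K f (Suc i))
                              - real (dim (boundaries (weakly_critical_complex K f) i)))"


section \<open>The block reduction construction\<close>

text \<open>
  Besides the current complex, the current function and the disjoint union of the elementary
  blocks set aside so far, a state records which moves have been made: the pairs \<open>(\<mu>, \<kappa>)\<close> whose
  block \<open>E(\<mu>, \<kappa>)\<close> was produced by Move (IV), and the cells removed by Move (II).  As the cells
  involved leave the current complex, no pair and no cell is recorded twice, so sets suffice for
  counting the moves.
\<close>

record 'a reduction_state =
  current :: "'a lefschetz"
  func :: "'a \<Rightarrow> real"
  aside :: "'a lefschetz"
  blocks :: "('a \<times> 'a) set"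
  removed :: "'a set"

definition as_long_as_possible :: "('s \<Rightarrow> 's \<Rightarrow> bool) \<Rightarrow> 's \<Rightarrow> 's \<Rightarrow> bool" where
  "as_long_as_possible r S S' \<longleftrightarrow> r\<^sup>*\<^sup>* S S' \<and> (\<nexists>T. r S' T)"

definition move_Ia :: "nat \<Rightarrow> 'a reduction_state \<Rightarrow> 'a reduction_state \<Rightarrow> bool" where
  "move_Ia j S S' \<longleftrightarrow> (\<exists>\<sigma> \<in> kcells (current S) j. \<exists>\<tau>.
     U_snc (current S) (func S) \<sigma> = 1 \<and> \<tau> \<in> up_cells (current S) (func S) \<sigma> \<and>
     S' = S\<lparr>current := reduce_pair (current S) \<tau> \<sigma>\<rparr>)"

definition move_Ib :: "nat \<Rightarrow> 'a reduction_state \<Rightarrow> 'a reduction_state \<Rightarrow> bool" where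
  "move_Ib n S S' \<longleftrightarrow> (\<exists>\<tau> \<in> cells (current S). \<exists>\<sigma> \<in> cells (current S).
     inc (current S) \<tau> \<sigma> \<noteq> 0 \<and> func S \<tau> = func S \<sigma> \<and>
     (cdim (current S) \<tau>, cdim (current S) \<sigma>) \<in> {(n + 2, n + 1), (n + 1, n)} \<and>
     S' = S\<lparr>current := reduce_pair (current S) \<tau> \<sigma>\<rparr>)"

definition shift :: "nat \<Rightarrow> 'a lefschetz \<Rightarrow> ('a \<Rightarrow> real) \<Rightarrow> real" where
  "shift n M g =
     (if kcells M (n + 2) = {} then 0 else real (n + 2) - Min (g ` kcells M (n + 2)))"

definition move_III :: "nat \<Rightarrow> 'a reduction_state \<Rightarrow> 'a reduction_state \<Rightarrow> bool" where
  "move_III n S S' \<longleftrightarrow>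
     S' = S\<lparr>func := (\<lambda>\<sigma>. if cdim (current S) \<sigma> \<le> n + 1 then real (cdim (current S) \<sigma>)
                         else func S \<sigma> + shift n (current S) (func S))\<rparr>"

definition move_IV :: "nat \<Rightarrow> 'a reduction_state \<Rightarrow> 'a reduction_state \<Rightarrow> bool" where
  "move_IV n S S' \<longleftrightarrow> (\<exists>\<kappa> \<in> kcells (current S) n. \<exists>\<mu> \<in> kcells (current S) (n + 1).
     inc (current S) \<mu> \<kappa> \<noteq> 0 \<and>
     S' = S\<lparr>current := reduce_pair (current S) \<mu> \<kappa>,
            aside := disjoint_sum (aside S) (elementary_block (cdim (current S)) \<mu> \<kappa>),
            blocks := insert (\<mu>, \<kappa>) (blocks S)\<rparr>)"

definition move_II :: "nat \<Rightarrow> 'a reduction_state \<Rightarrow> 'a reduction_state \<Rightarrow> bool" where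
  "move_II n S S' \<longleftrightarrow> (\<exists>\<eta> \<in> kcells (current S) n. isolated (current S) \<eta> \<and>
     S' = S\<lparr>current := remove_cell (current S) \<eta>, removed := insert \<eta> (removed S)\<rparr>)"

definition remove_all :: "nat \<Rightarrow> 'a reduction_state \<Rightarrow> 'a reduction_state \<Rightarrow> bool" where
  "remove_all n S S' \<longleftrightarrow> (move_II n)\<^sup>*\<^sup>* S S' \<and> kcells (current S') n = {}"

definition stage :: "nat \<Rightarrow> 'a reduction_state \<Rightarrow> 'a reduction_state \<Rightarrow> bool" where
  "stage n =
     as_long_as_possible (move_Ia n) OO
     as_long_as_possible (move_Ia (n + 1)) OO
     as_long_as_possible (move_Ia (n + 2)) OO
     as_long_as_possible (move_Ib n) OO
     move_III n OO
     as_long_as_possible (move_IV n) OO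
     remove_all n"

text \<open>
  \<open>S n\<close> is the state before stage \<open>n\<close>; the relations above leave all choices open, so the
  sequences below are exactly the possible outcomes of the construction.
\<close>

definition block_reduction ::
    "'a lefschetz \<Rightarrow> ('a \<Rightarrow> real) \<Rightarrow> (nat \<Rightarrow> 'a reduction_state) \<Rightarrow> bool" where
  "block_reduction K f S \<longleftrightarrow>
     S 0 = \<lparr>current = K, func = f, aside = empty_complex, blocks = {}, removed = {}\<rparr> \<and>
     (\<forall>n. stage n (S n) (S (Suc n)))"

definition produced_blocks ::
    "'a lefschetz \<Rightarrow> (nat \<Rightarrow> 'a reduction_state) \<Rightarrow> nat \<Rightarrow> ('a \<times> 'a) set" where
  "produced_blocks K S d = {(\<mu>, \<kappa>) \<in> (\<Union>n. blocks (S n)). cdim K \<mu> = d}"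

definition removed_cells ::
    "'a lefschetz \<Rightarrow> (nat \<Rightarrow> 'a reduction_state) \<Rightarrow> nat \<Rightarrow> 'a set" where
  "removed_cells K S k = {\<eta> \<in> (\<Union>n. removed (S n)). cdim K \<eta> = k}"

end

theory Submission
  imports Defs
begin

text \<open>
  Put \<open>excess\<^sub>k = rank B\<^sub>k(K) - d\<^sub>k\<^sub>+\<^sub>1 - rank B\<^sub>k(W)\<close>, the coefficient of \<open>t\<^sup>k\<close> in \<open>R\<^sub>t\<close>, where \<open>W\<close> is the
  complex of weakly critical cells.  The theorem expresses two conservation laws, valid for every
  \<open>k\<close> and at every moment of the construction: the sum of the \<open>k\<close>-th Betti number of the current
  complex and the number of \<open>k\<close>-cells removed so far is constant, and so is the sum of \<open>excess\<^sub>k\<close> and the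
  number of blocks \<open>E(\<mu>, \<kappa>)\<close> with \<open>\<mu>\<close> of dimension \<open>k + 1\<close> produced so far.  After stage \<open>k\<close> all
  current cells have dimension greater than \<open>k\<close>, so that the Betti number and the excess are \<open>0\<close> and
  the counts equal the values for \<open>K\<close> (\<open>block_reduction_counts\<close>).

  The laws rest on one fact of linear algebra: removing a pair \<open>\<mu>, \<kappa>\<close> of dimensions \<open>k + 1\<close> and \<open>k\<close>
  lowers the rank of \<open>B\<^sub>k\<close> by one and preserves all other ranks (\<open>boundary_rank_reduce_pair\<close>); in
  particular it preserves the Betti numbers.  What happens to the excess depends on the pair.  A
  reversed pair, with \<open>f \<mu> < f \<kappa>\<close>, takes away one cell counted in \<open>d\<^sub>k\<^sub>+\<^sub>1\<close> and does not touch \<open>W\<close>,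
  so the excess stays (\<open>excess_reduce_reversed\<close>).  A level pair of weakly critical cells is removed
  from \<open>W\<close> in the same way as from \<open>K\<close>, so the two ranks drop together (\<open>excess_reduce_level\<close>).  After
  these pairs are gone, the third move can change the function to the dimension in low dimensions
  without changing any comparison along an incidence (\<open>phase_III\<close>).  From then on the cells handled
  by the fourth move are isolated in \<open>W\<close>, so each block lowers the rank of \<open>B\<^sub>n(K)\<close> alone, and the
  excess by one (\<open>excess_reduce_dimension\<close>).  Removing an isolated cell changes no rank, only the
  number of cells (\<open>betti_remove_isolated\<close>, \<open>excess_remove_isolated\<close>).

  That the coefficients of \<open>R\<^sub>t\<close> are natural numbers is asserted without reference to a run.  It
  follows from the existence of one (\<open>block_reduction_exists\<close>): every loop terminates because it
  lowers the number of cells of a fixed dimension, and these numbers are finite.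
\<close>

section \<open>Ranks of quotients\<close>

lemma complementary_basis:
  fixes V W :: "'v::real_vector set"
  assumes "subspace V" "subspace W" "W \<subseteq> V" "finite F" "V \<subseteq> span F"
  obtains B C where "finite B" "finite C" "B \<inter> C = {}" "independent (B \<union> C)"
    "span C = W" "span (B \<union> C) = V"
proof -
  obtain C where C: "C \<subseteq> W" "independent C" "W \<subseteq> span C"
    using maximal_independent_subset by blast
  obtain D where D: "C \<subseteq> D" "D \<subseteq> V" "independent D" "V \<subseteq> span D"
    using maximal_independent_subset_extend[of C V] C assms(3) by blast
  have "finite D"
    using independent_span_bound[OF assms(4) D(3)] D(2) assms(5) by blast
  show thesis
  proof (rule that[of "D - C" C])
    show "span C = W"
      using C span_minimal[OF C(1) assms(2)] by blast
    show "span (D - C \<union> C) = V"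
      using D span_minimal[OF D(2) assms(1)] by (simp add: Un_absorb2 subset_antisym)
  qed (use \<open>finite D\<close> D finite_subset in \<open>auto simp: Un_absorb2\<close>)
qed

text \<open>
  If \<open>C\<close> is a basis of \<open>W\<close> and \<open>B \<union> C\<close> one of \<open>V\<close>, the cosets of \<open>B\<close> form a basis of \<open>V / W\<close>.
  Besides yielding a quotient basis, this expresses that \<open>span B\<close> meets \<open>W\<close> only in \<open>0\<close>.
\<close>

lemma quotient_basis_complement:
  fixes B C :: "'v::real_vector set"
  assumes "finite B" "finite C" "B \<inter> C = {}" "independent (B \<union> C)"
  shows "quotient_basis (span (B \<union> C)) (span C) B"
  unfolding quotient_basis_def
proof (intro conjI allI impI ballI)
  show "finite B" "B \<subseteq> span (B \<union> C)"
    using assms by (auto intro: span_base)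
next
  fix a b
  assume "(\<Sum>b\<in>B. a b *\<^sub>R b) \<in> span C" and b: "b \<in> B"
  then obtain u where u: "(\<Sum>b\<in>B. a b *\<^sub>R b) = (\<Sum>c\<in>C. u c *\<^sub>R c)"
    unfolding span_finite[OF assms(2)] by auto
  define w where "w v = (if v \<in> B then a v else - u v)" for v
  have "(\<Sum>v\<in>B \<union> C. w v *\<^sub>R v) = (\<Sum>v\<in>B. w v *\<^sub>R v) + (\<Sum>v\<in>C. w v *\<^sub>R v)"
    using assms by (intro sum.union_disjoint) auto
  also have "(\<Sum>v\<in>B. w v *\<^sub>R v) = (\<Sum>b\<in>B. a b *\<^sub>R b)"
    by (intro sum.cong) (auto simp: w_def)
  also have "(\<Sum>v\<in>C. w v *\<^sub>R v) = - (\<Sum>c\<in>C. u c *\<^sub>R c)"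
    unfolding sum_negf[symmetric] using assms(3) by (intro sum.cong) (auto simp: w_def)
  finally have "(\<Sum>v\<in>B \<union> C. w v *\<^sub>R v) = 0"
    using u by simp
  then have "w b = 0"
    using independentD[OF assms(4) _ order_refl] assms(1,2) b by blast
  then show "a b = 0"
    using b by (simp add: w_def)
next
  fix v
  assume "v \<in> span (B \<union> C)"
  then obtain x y where "v = x + y" "x \<in> span B" "y \<in> span C"
    unfolding span_Un by auto
  moreover then obtain a where "x = (\<Sum>b\<in>B. a b *\<^sub>R b)"
    unfolding span_finite[OF assms(1)] by auto
  ultimately show "\<exists>a. v - (\<Sum>b\<in>B. a b *\<^sub>R b) \<in> span C"
    by (metis add_diff_cancel_left')
qed

text \<open>
  The rank of a quotient is read off an arbitrarily chosen quotient basis.  Its size does not depend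
  on the choice, because joined with a basis of \<open>W\<close> it becomes a basis of \<open>V\<close>.
\<close>

lemma card_quotient_basis:
  fixes V W :: "'v::real_vector set"
  assumes "subspace V" "subspace W" "W \<subseteq> V" "finite F" "V \<subseteq> span F" "quotient_basis V W B"
  shows "card B + dim W = dim V"
proof -
  obtain C where C: "C \<subseteq> W" "independent C" "W \<subseteq> span C" "card C = dim W"
    using basis_exists by blast
  have "finite C"
    using independent_span_bound[OF assms(4) C(2)] C(1) assms(3,5) by blast
  have B: "finite B" "B \<subseteq> V"
    and ind: "\<And>a b. (\<Sum>b\<in>B. a b *\<^sub>R b) \<in> W \<Longrightarrow> b \<in> B \<Longrightarrow> a b = 0"
    and gen: "\<And>v. v \<in> V \<Longrightarrow> \<exists>a. v - (\<Sum>b\<in>B. a b *\<^sub>R b) \<in> W"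
    using assms(6) unfolding quotient_basis_def by blast+
  have disj: "B \<inter> C = {}"
  proof (rule ccontr)
    assume "B \<inter> C \<noteq> {}"
    then obtain b where b: "b \<in> B" "b \<in> W"
      using C(1) by blast
    have "(\<Sum>v\<in>B. (if v = b then 1 else 0) *\<^sub>R v) = (\<Sum>v\<in>B. if v = b then v else 0)"
      by (intro sum.cong) auto
    also have "\<dots> = b"
      using b(1) B(1) by simp
    finally show False
      using ind[of "\<lambda>v. if v = b then 1 else 0" b] b by simp
  qed
  have "independent (B \<union> C)"
  proof (rule independent_if_scalars_zero)
    fix w x
    assume 0: "(\<Sum>v\<in>B \<union> C. w v *\<^sub>R v) = 0" and x: "x \<in> B \<union> C"
    have split: "(\<Sum>v\<in>B. w v *\<^sub>R v) + (\<Sum>v\<in>C. w v *\<^sub>R v) = 0"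
      using 0 sum.union_disjoint[OF B(1) \<open>finite C\<close> disj, of "\<lambda>v. w v *\<^sub>R v"] by simp
    have inW: "(\<Sum>v\<in>C. w v *\<^sub>R v) \<in> W"
      using C(1) assms(2) by (intro subspace_sum subspace_scale) auto
    have "(\<Sum>v\<in>B. w v *\<^sub>R v) = - (\<Sum>v\<in>C. w v *\<^sub>R v)"
      using split by (simp add: eq_neg_iff_add_eq_0)
    then have wB: "w b = 0" if "b \<in> B" for b
      using ind[of w b] that subspace_neg[OF assms(2) inW] by simp
    then have "(\<Sum>v\<in>C. w v *\<^sub>R v) = 0"
      using split by simp
    then show "w x = 0"
      using x wB independentD[OF C(2) \<open>finite C\<close> order_refl] by blast
  qed (use B \<open>finite C\<close> in auto)
  moreover have "V \<subseteq> span (B \<union> C)"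
  proof
    fix v
    assume "v \<in> V"
    then obtain a where a: "v - (\<Sum>b\<in>B. a b *\<^sub>R b) \<in> W"
      using gen by blast
    have "(\<Sum>b\<in>B. a b *\<^sub>R b) \<in> span (B \<union> C)"
      by (intro span_sum span_scale span_base) auto
    moreover have "v - (\<Sum>b\<in>B. a b *\<^sub>R b) \<in> span (B \<union> C)"
      using a C(3) span_mono[of C "B \<union> C"] by blast
    ultimately show "v \<in> span (B \<union> C)"
      using span_add by fastforce
  qed
  moreover have "B \<union> C \<subseteq> V"
    using B C assms(3) by auto
  ultimately have "card (B \<union> C) = dim V"
    using basis_card_eq_dim by blast
  then show ?thesis
    using card_Un_disjoint[OF B(1) \<open>finite C\<close> disj] C(4) by simp
qed

lemma quotient_rank_eq:
  fixes V W :: "'v::real_vector set"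
  assumes "subspace V" "subspace W" "W \<subseteq> V" "finite F" "V \<subseteq> span F"
  shows "quotient_rank V W + dim W = dim V"
proof -
  obtain B C where "finite B" "finite C" "B \<inter> C = {}" "independent (B \<union> C)"
    "span C = W" "span (B \<union> C) = V"
    using complementary_basis[OF assms] by blast
  then have "quotient_basis V W B"
    using quotient_basis_complement by blast
  then have "quotient_basis V W (SOME B. quotient_basis V W B)"
    by (rule someI)
  then show ?thesis
    unfolding quotient_rank_def using card_quotient_basis[OF assms] by blast
qed

text \<open>
  Complete a basis of the kernel by \<open>B\<close> to a basis of \<open>V\<close>; then \<open>f\<close> is injective on \<open>span B\<close> and
  maps it onto \<open>f ` V\<close>.  The ambient spaces may have infinite dimension.
\<close>

lemma rank_nullity:
  fixes f :: "'v::real_vector \<Rightarrow> 'w::real_vector"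
  assumes "linear f" "subspace V" "finite F" "V \<subseteq> span F"
  shows "dim {v \<in> V. f v = 0} + dim (f ` V) = dim V"
proof -
  let ?W = "{v \<in> V. f v = 0}"
  have "subspace ?W"
    using assms(1,2) unfolding subspace_def
    by (auto simp: linear_0 linear_add linear_scale)
  then obtain B C where BC: "finite B" "finite C" "B \<inter> C = {}" "independent (B \<union> C)"
    "span C = ?W" "span (B \<union> C) = V"
    using complementary_basis[of V ?W F] assms by blast
  have "quotient_basis V ?W B"
    using quotient_basis_complement[OF BC(1-4)] BC(5,6) by simp
  then have zero: "\<And>a b. (\<Sum>b\<in>B. a b *\<^sub>R b) \<in> ?W \<Longrightarrow> b \<in> B \<Longrightarrow> a b = 0"
    unfolding quotient_basis_def by blast
  have "x = 0" if x: "x \<in> span B" and "f x = 0" for x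
  proof -
    obtain a where a: "x = (\<Sum>b\<in>B. a b *\<^sub>R b)"
      using x unfolding span_finite[OF BC(1)] by auto
    have "x \<in> ?W"
      using that BC(6) span_mono[of B "B \<union> C"] by auto
    then show ?thesis
      using zero a by (auto intro: sum.neutral)
  qed
  then have inj: "inj_on f (span B)"
    using linear_inj_on_iff_eq_0[OF assms(1)] by (metis subspace_span)
  have "independent B"
    using BC(4) independent_mono by blast
  then have ind: "independent (f ` B)"
    using linear_independent_injective_image[OF assms(1)] inj by blast
  have "f ` C \<subseteq> {0}"
    using BC(5) span_base by fastforce
  then have "span (f ` B) = span (f ` (B \<union> C))"
    by (metis Un_empty_right image_Un span_insert_0 subset_singletonD Un_insert_right)
  also have "\<dots> = f ` V"
    using linear_span_image[OF assms(1)] BC(6) by blast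
  finally have "dim (f ` V) = card (f ` B)"
    using ind by (metis dim_span_eq_card_independent)
  also have "\<dots> = card B"
    using inj inj_on_subset span_superset by (metis card_image)
  finally have 1: "dim (f ` V) = card B" .
  have "dim ?W = card C"
    using BC(4,5) by (metis dim_span_eq_card_independent independent_mono Un_upper2)
  moreover have "dim V = card B + card C"
    using BC by (metis dim_span_eq_card_independent card_Un_disjoint)
  ultimately show ?thesis
    using 1 by simp
qed

lemma dim_image_inj_on_span:
  fixes f :: "'v::real_vector \<Rightarrow> 'w::real_vector"
  assumes "linear f" "finite S" "\<And>v. v \<in> span S \<Longrightarrow> f v = 0 \<Longrightarrow> v = 0"
  shows "dim (f ` S) = dim S"
proof -
  have "{v \<in> span S. f v = 0} = {0}"
    using assms by (auto simp: linear_0 span_zero)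
  moreover have "dim {0::'v} = 0"
    using dim_eq_card[of "{}" "{0::'v}"] by (simp add: independent_empty)
  ultimately have "dim (f ` span S) = dim S"
    using rank_nullity[OF assms(1) subspace_span assms(2) order_refl] by simp
  then show ?thesis
    using linear_span_image[OF assms(1), of S] by (metis dim_span)
qed

lemma dim_insert_independent:
  fixes x :: "'v::real_vector"
  assumes "finite S" "x \<notin> span S"
  shows "dim (insert x S) = Suc (dim S)"
proof -
  obtain B where B: "B \<subseteq> S" "independent B" "S \<subseteq> span B" "card B = dim S"
    using basis_exists by blast
  have "x \<notin> span B"
    using assms(2) span_mono[OF B(1)] by blast
  then have "independent (insert x B)" "x \<notin> B"
    using B(2) independent_insertI span_base by blast+
  moreover have "insert x S \<subseteq> span (insert x B)"
    using B(3) span_mono[of B "insert x B"] by (auto intro: span_base)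
  ultimately have "card (insert x B) = dim (insert x S)"
    using B(1) by (intro basis_card_eq_dim) auto
  then show ?thesis
    using B assms(1) \<open>x \<notin> B\<close> finite_subset by (metis card_insert_disjoint)
qed

section \<open>Boundary ranks and Betti numbers\<close>

lemma lookup_scaleR: "Poly_Mapping.lookup (r *\<^sub>R x) i = r *\<^sub>R Poly_Mapping.lookup x i"
proof -
  have "finite {i. r *\<^sub>R Poly_Mapping.lookup x i \<noteq> 0}"
    by (rule finite_subset[OF _ finite_lookup[of x]]) auto
  then show ?thesis
    by (simp add: scaleR_poly_mapping_def lookup_Abs_poly_mapping)
qed

lemmas lookup_linear = lookup_scaleR lookup_add lookup_minus lookup_single when_def

lemma mem_kcells: "\<sigma> \<in> kcells K k \<longleftrightarrow> \<sigma> \<in> cells K \<and> cdim K \<sigma> = k"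
  by (simp add: kcells_def)

context lefschetz_complex
begin

lemma inc_nonzero_dim:
  "\<lbrakk>\<tau> \<in> cells K; \<sigma> \<in> cells K; inc K \<tau> \<sigma> \<noteq> 0\<rbrakk> \<Longrightarrow> cdim K \<tau> = Suc (cdim K \<sigma>)"
  using inc_dim[of \<tau> \<sigma>] by linarith

lemma inc_eq_0: "\<lbrakk>\<tau> \<in> cells K; \<sigma> \<in> cells K; cdim K \<tau> \<noteq> Suc (cdim K \<sigma>)\<rbrakk> \<Longrightarrow> inc K \<tau> \<sigma> = 0"
  using inc_nonzero_dim by blast

text \<open>
  The second incidence axiom with a range of summation that does not depend on the two outer cells,
  so that several of its instances can be combined.
\<close>

lemma inc_inc_kcells:
  assumes "\<tau> \<in> cells K" "\<nu> \<in> cells K"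
  shows "(\<Sum>\<sigma>\<in>kcells K i. inc K \<tau> \<sigma> * inc K \<sigma> \<nu>) = 0"
proof (cases "cdim K \<tau> = Suc i")
  case True
  have "(\<Sum>\<sigma>\<in>kcells K i. inc K \<tau> \<sigma> * inc K \<sigma> \<nu>)
      = (\<Sum>\<sigma> | \<sigma> \<in> cells K \<and> inc K \<tau> \<sigma> * inc K \<sigma> \<nu> \<noteq> 0. inc K \<tau> \<sigma> * inc K \<sigma> \<nu>)"
    using finite_kcells[of i] inc_nonzero_dim[of \<tau>] assms True
    by (intro sum.mono_neutral_right) (auto simp: mem_kcells)
  then show ?thesis
    using inc_inc assms by simp
next
  case False
  then show ?thesis
    using inc_eq_0[OF assms(1)] by (intro sum.neutral) (auto simp: mem_kcells)
qed

lemma lookup_cell_boundary: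
  "Poly_Mapping.lookup (cell_boundary K \<tau>) \<sigma> =
     (if \<sigma> \<in> cells K \<and> Suc (cdim K \<sigma>) = cdim K \<tau> then inc K \<tau> \<sigma> else 0)"
proof -
  have "{\<sigma> \<in> cells K. Suc (cdim K \<sigma>) = cdim K \<tau>} \<subseteq> kcells K (cdim K \<tau> - 1)"
    by (auto simp: kcells_def)
  then have "finite {\<sigma> \<in> cells K. Suc (cdim K \<sigma>) = cdim K \<tau>}"
    using finite_kcells finite_subset by blast
  then show ?thesis
    by (simp add: cell_boundary_def lookup_sum lookup_linear if_distrib sum.If_cases cong: if_cong)
qed

lemma linear_boundary: "linear (boundary K k)"
  by (rule linearI)
    (simp_all add: boundary_def lookup_linear scaleR_left_distrib sum.distrib scaleR_sum_right)

lemma boundary_single: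
  assumes "\<tau> \<in> kcells K k"
  shows "boundary K k (Poly_Mapping.single \<tau> 1) = cell_boundary K \<tau>"
proof -
  have "boundary K k (Poly_Mapping.single \<tau> 1)
      = (\<Sum>\<sigma>\<in>kcells K k. if \<tau> = \<sigma> then cell_boundary K \<sigma> else 0)"
    unfolding boundary_def by (intro sum.cong) (auto simp: lookup_linear)
  then show ?thesis
    using assms finite_kcells by simp
qed

lemma image_boundary: "boundary K k ` chains K k = span (cell_boundary K ` kcells K k)"
proof -
  have "boundary K k ` (\<lambda>\<sigma>. Poly_Mapping.single \<sigma> 1) ` kcells K k = cell_boundary K ` kcells K k"
    unfolding image_image by (intro image_cong) (auto simp: boundary_single)
  then show ?thesis
    unfolding chains_def using linear_span_image[OF linear_boundary] by metis
qed

end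

text \<open>
  This is \<open>rank B\<^sub>k\<^sub>-\<^sub>1\<close>, indexed by the source of the boundary map: the index \<open>0\<close> then makes sense
  and gives rank \<open>0\<close>.
\<close>

definition boundary_rank :: "'a lefschetz \<Rightarrow> nat \<Rightarrow> nat" where
  "boundary_rank K k = dim (cell_boundary K ` kcells K k)"

lemma independent_singles: "independent ((\<lambda>\<sigma>. Poly_Mapping.single \<sigma> (1::real)) ` A)"
proof -
  have "u x = 0"
    if T: "finite T" "T \<subseteq> (\<lambda>\<sigma>. Poly_Mapping.single \<sigma> (1::real)) ` A"
      and 0: "(\<Sum>v\<in>T. u v *\<^sub>R v) = 0" and x: "x \<in> T" for T u x
  proof -
    obtain \<sigma> where \<sigma>: "x = Poly_Mapping.single \<sigma> 1"
      using T x by blast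
    have "u v * Poly_Mapping.lookup v \<sigma> = (if v = x then u v else 0)" if "v \<in> T" for v
      using that T(2) \<sigma> by (fastforce simp: lookup_single when_def split: if_splits)
    then have "(\<Sum>v\<in>T. u v * Poly_Mapping.lookup v \<sigma>) = u x"
      using x T(1) by simp
    moreover have "(\<Sum>v\<in>T. u v * Poly_Mapping.lookup v \<sigma>) = Poly_Mapping.lookup (\<Sum>v\<in>T. u v *\<^sub>R v) \<sigma>"
      by (simp add: lookup_sum lookup_scaleR)
    ultimately show "u x = 0"
      using 0 by simp
  qed
  then show ?thesis
    unfolding independent_explicit_module by blast
qed

context lefschetz_complex
begin

lemma dim_boundaries: "dim (boundaries K k) = boundary_rank K (Suc k)"
  by (simp add: boundaries_def image_boundary boundary_rank_def)

lemma dim_chains: "dim (chains K k) = card (kcells K k)"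
proof -
  have "inj_on (\<lambda>\<sigma>. Poly_Mapping.single \<sigma> (1::real)) (kcells K k)"
    by (rule inj_onI) (metis lookup_single_eq lookup_single_not_eq zero_neq_one)
  then show ?thesis
    unfolding chains_def using dim_span_eq_card_independent[OF independent_singles] card_image by metis
qed

lemma boundary_boundary:
  assumes "\<tau> \<in> cells K"
  shows "boundary K k (cell_boundary K \<tau>) = 0"
proof (rule poly_mapping_eqI)
  fix \<nu>
  show "Poly_Mapping.lookup (boundary K k (cell_boundary K \<tau>)) \<nu> = Poly_Mapping.lookup 0 \<nu>"
  proof (cases "cdim K \<tau> = Suc k \<and> \<nu> \<in> cells K \<and> Suc (cdim K \<nu>) = k")
    case True
    have "Poly_Mapping.lookup (boundary K k (cell_boundary K \<tau>)) \<nu>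
        = (\<Sum>\<sigma>\<in>kcells K k. inc K \<tau> \<sigma> * inc K \<sigma> \<nu>)"
      unfolding boundary_def lookup_sum
      using True by (intro sum.cong) (auto simp: lookup_scaleR lookup_cell_boundary mem_kcells)
    then show ?thesis
      using inc_inc_kcells assms True by simp
  next
    case False
    then show ?thesis
      unfolding boundary_def lookup_sum
      by (auto simp: lookup_scaleR lookup_cell_boundary mem_kcells intro!: sum.neutral)
  qed
qed

lemma cell_boundary_in_chains:
  assumes "\<tau> \<in> kcells K (Suc k)"
  shows "cell_boundary K \<tau> \<in> chains K k"
  using assms unfolding cell_boundary_def chains_def
  by (intro span_sum span_scale span_base) (auto simp: mem_kcells)

text \<open>
  Rank and nullity of the boundary map out of dimension \<open>k\<close>, with the boundaries coming from
  dimension \<open>k + 1\<close> divided out.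
\<close>

lemma betti_eq: "betti K k + boundary_rank K k + boundary_rank K (Suc k) = card (kcells K k)"
proof -
  let ?F = "(\<lambda>\<sigma>. Poly_Mapping.single \<sigma> (1::real)) ` kcells K k"
  have fin: "finite ?F"
    using finite_kcells by blast
  have sub: "subspace (cycles K k)"
    using linear_boundary[of k] unfolding cycles_def chains_def subspace_def
    by (auto simp: linear_0 linear_add linear_scale span_zero span_add span_scale)
  have "cell_boundary K \<tau> \<in> cycles K k" if "\<tau> \<in> kcells K (Suc k)" for \<tau>
    using that cell_boundary_in_chains boundary_boundary by (simp add: cycles_def mem_kcells)
  then have B: "boundaries K k \<subseteq> cycles K k"
    unfolding boundaries_def image_boundary by (intro span_minimal sub) auto
  have "subspace (boundaries K k)"
    unfolding boundaries_def image_boundary by (rule subspace_span)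
  then have "quotient_rank (cycles K k) (boundaries K k) + dim (boundaries K k) = dim (cycles K k)"
    using B sub fin by (intro quotient_rank_eq[of _ _ ?F]) (auto simp: cycles_def chains_def)
  moreover have "dim (cycles K k) + dim (boundary K k ` chains K k) = dim (chains K k)"
    unfolding cycles_def
    by (rule rank_nullity[OF linear_boundary _ fin]) (simp_all add: chains_def)
  ultimately show ?thesis
    by (simp add: betti_def dim_boundaries image_boundary dim_chains boundary_rank_def[symmetric])
qed

end

section \<open>Reducing a pair of cells\<close>

lemma reduce_pair_simps [simp]:
  "cells (reduce_pair K \<mu> \<kappa>) = cells K - {\<mu>, \<kappa>}"
  "cdim (reduce_pair K \<mu> \<kappa>) = cdim K"
  "inc (reduce_pair K \<mu> \<kappa>) \<tau> \<sigma> = inc K \<tau> \<sigma> - inc K \<tau> \<kappa> * inc K \<mu> \<sigma> / inc K \<mu> \<kappa>"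
  by (simp_all add: reduce_pair_def)

lemma kcells_reduce_pair: "kcells (reduce_pair K \<mu> \<kappa>) k = kcells K k - {\<mu>, \<kappa>}"
  by (auto simp: kcells_def)

text \<open>
  Removing an incident pair is one step of Gaussian elimination on the matrix of the boundary map,
  with pivot at \<open>(\<mu>, \<kappa>)\<close>.  Only the rank of this one matrix drops, because the row and the column
  deleted from the two neighbouring matrices depend linearly on the others, by \<open>\<partial>\<partial> = 0\<close>.
\<close>

locale incident_pair = lefschetz_complex K for K :: "'a lefschetz" +
  fixes \<mu> \<kappa> :: 'a
  assumes mu: "\<mu> \<in> cells K" and kappa: "\<kappa> \<in> cells K" and incident: "inc K \<mu> \<kappa> \<noteq> 0"
begin

lemma dim_mu: "cdim K \<mu> = Suc (cdim K \<kappa>)"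
  using inc_nonzero_dim mu kappa incident by blast

text \<open>
  The new incidence numbers are \<open>w(\<tau>, \<sigma>) - a w(\<mu>, \<sigma>)\<close> and \<open>w(\<sigma>, \<nu>) - b w(\<sigma>, \<kappa>)\<close>, where \<open>a\<close> and
  \<open>b\<close> do not depend on \<open>\<sigma>\<close>.  Multiplying out therefore splits the sum of their products into four
  sums that vanish in \<open>K\<close>.
\<close>

lemma lefschetz_reduce_pair: "lefschetz_complex (reduce_pair K \<mu> \<kappa>)"
proof
  let ?L = "reduce_pair K \<mu> \<kappa>"
  show "finite (kcells ?L k)" for k
    using finite_kcells by (simp add: kcells_reduce_pair)
  show dimL: "int (cdim ?L \<tau>) - int (cdim ?L \<sigma>) = 1"
    if "\<tau> \<in> cells ?L" "\<sigma> \<in> cells ?L" "inc ?L \<tau> \<sigma> \<noteq> 0" for \<tau> \<sigma>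
  proof (cases "inc K \<tau> \<sigma> = 0")
    case True
    then have "inc K \<tau> \<kappa> \<noteq> 0" "inc K \<mu> \<sigma> \<noteq> 0"
      using that by auto
    then show ?thesis
      using inc_nonzero_dim[of \<tau> \<kappa>] inc_nonzero_dim[of \<mu> \<sigma>] dim_mu mu kappa that by simp
  next
    case False
    then show ?thesis
      using inc_dim that by simp
  qed
  show "(\<Sum>\<sigma> | \<sigma> \<in> cells ?L \<and> inc ?L \<tau> \<sigma> * inc ?L \<sigma> \<nu> \<noteq> 0. inc ?L \<tau> \<sigma> * inc ?L \<sigma> \<nu>) = 0"
    if \<tau>\<nu>: "\<tau> \<in> cells ?L" "\<nu> \<in> cells ?L" for \<tau> \<nu>
  proof -
    let ?i = "cdim K \<tau> - 1"
    define a where "a = inc K \<tau> \<kappa> / inc K \<mu> \<kappa>"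
    define b where "b = inc K \<mu> \<nu> / inc K \<mu> \<kappa>"
    have "(\<Sum>\<sigma> | \<sigma> \<in> cells ?L \<and> inc ?L \<tau> \<sigma> * inc ?L \<sigma> \<nu> \<noteq> 0. inc ?L \<tau> \<sigma> * inc ?L \<sigma> \<nu>)
        = (\<Sum>\<sigma>\<in>kcells K ?i. inc ?L \<tau> \<sigma> * inc ?L \<sigma> \<nu>)"
      (* The new incidence numbers vanish on the removed pair, so that it may be kept in the sum. *)
    proof (rule sum.mono_neutral_left)
      show "finite (kcells K ?i)"
        by (rule finite_kcells)
      show "{\<sigma> \<in> cells ?L. inc ?L \<tau> \<sigma> * inc ?L \<sigma> \<nu> \<noteq> 0} \<subseteq> kcells K ?i"
        using dimL[OF \<tau>\<nu>(1)] by (force simp: mem_kcells simp del: reduce_pair_simps(3))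
      show "\<forall>\<sigma>\<in>kcells K ?i - {\<sigma> \<in> cells ?L. inc ?L \<tau> \<sigma> * inc ?L \<sigma> \<nu> \<noteq> 0}.
              inc ?L \<tau> \<sigma> * inc ?L \<sigma> \<nu> = 0"
        using incident by (auto simp: mem_kcells)
    qed
    also have "\<dots> = (\<Sum>\<sigma>\<in>kcells K ?i. inc K \<tau> \<sigma> * inc K \<sigma> \<nu> - a * (inc K \<mu> \<sigma> * inc K \<sigma> \<nu>)
          - b * (inc K \<tau> \<sigma> * inc K \<sigma> \<kappa>) + a * b * (inc K \<mu> \<sigma> * inc K \<sigma> \<kappa>))"
      by (intro sum.cong) (auto simp: a_def b_def algebra_simps)
    also have "\<dots> = 0"
      using inc_inc_kcells \<tau>\<nu> mu kappa by (simp add: sum.distrib sum_subtractf sum_distrib_left[symmetric])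
    finally show ?thesis .
  qed
qed

text \<open>
  The new boundaries arise from the old ones by clearing the coefficient at \<open>\<kappa>\<close> with a multiple of
  the boundary of \<open>\<mu>\<close>, which itself has a nonzero coefficient there and is hence independent of them.
\<close>

lemma boundary_rank_reduce_pair_top:
  "boundary_rank K (cdim K \<mu>) = Suc (boundary_rank (reduce_pair K \<mu> \<kappa>) (cdim K \<mu>))"
proof -
  let ?L = "reduce_pair K \<mu> \<kappa>" and ?d = "cdim K \<mu>"
  interpret L: lefschetz_complex ?L
    by (rule lefschetz_reduce_pair)
  let ?v = "cell_boundary K" and ?v' = "cell_boundary ?L"
  let ?S = "?v ` kcells K ?d" and ?S' = "?v' ` kcells ?L ?d"
  define a where "a \<tau> = inc K \<tau> \<kappa> / inc K \<mu> \<kappa>" for \<tau>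
  have fin: "finite ?S'"
    using L.finite_kcells by blast
  have v': "?v' \<tau> = ?v \<tau> - a \<tau> *\<^sub>R ?v \<mu>" if "\<tau> \<in> kcells ?L ?d" for \<tau>
    using that incident dim_mu
    by (intro poly_mapping_eqI)
      (auto simp: lookup_linear lookup_cell_boundary L.lookup_cell_boundary mem_kcells a_def)
  have "Poly_Mapping.lookup x \<kappa> = 0" if "x \<in> span ?S'" for x
    using that
  proof (rule span_induct)
    show "subspace {x. Poly_Mapping.lookup x \<kappa> = 0}"
      by (auto simp: subspace_def lookup_linear)
  qed (auto simp: L.lookup_cell_boundary)
  moreover have "Poly_Mapping.lookup (?v \<mu>) \<kappa> \<noteq> 0"
    using kappa incident dim_mu by (simp add: lookup_cell_boundary)
  ultimately have "?v \<mu> \<notin> span ?S'"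
    by blast
  then have "dim (insert (?v \<mu>) ?S') = Suc (dim ?S')"
    using dim_insert_independent fin by blast
  moreover have "span ?S = span (insert (?v \<mu>) ?S')"
    unfolding span_eq
  proof
    have "?v \<tau> \<in> span (insert (?v \<mu>) ?S')" if "\<tau> \<in> kcells K ?d" for \<tau>
    proof (cases "\<tau> = \<mu>")
      case False
      then have "\<tau> \<in> kcells ?L ?d"
        using that dim_mu by (auto simp: mem_kcells)
      then have "?v' \<tau> + a \<tau> *\<^sub>R ?v \<mu> \<in> span (insert (?v \<mu>) ?S')"
        by (intro span_add span_scale span_base) auto
      then show ?thesis
        using v' \<open>\<tau> \<in> kcells ?L ?d\<close> by simp
    qed (simp add: span_base)
    then show "?S \<subseteq> span (insert (?v \<mu>) ?S')"
      by blast
    have mu': "\<mu> \<in> kcells K ?d" and sub: "kcells ?L ?d \<subseteq> kcells K ?d"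
      using mu by (auto simp: mem_kcells)
    have "?v \<tau> - a \<tau> *\<^sub>R ?v \<mu> \<in> span ?S" if "\<tau> \<in> kcells K ?d" for \<tau>
      using that mu' by (intro span_diff span_scale span_base) auto
    then show "insert (?v \<mu>) ?S' \<subseteq> span ?S"
      using sub mu' by (auto simp: v' span_base)
  qed
  ultimately show ?thesis
    unfolding boundary_rank_def by (metis span_eq_dim)
qed

text \<open>
  One dimension up, the reduction merely forgets the coefficient at \<open>\<mu>\<close>.  Nothing is lost: the
  boundaries are cycles, and the vanishing of the coefficient of their boundary at \<open>\<kappa>\<close> determines
  the coefficient at \<open>\<mu>\<close> from the others.
\<close>

lemma boundary_rank_reduce_pair_above:
  "boundary_rank (reduce_pair K \<mu> \<kappa>) (Suc (cdim K \<mu>)) = boundary_rank K (Suc (cdim K \<mu>))"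
proof -
  let ?L = "reduce_pair K \<mu> \<kappa>" and ?d = "Suc (cdim K \<mu>)"
  interpret L: lefschetz_complex ?L
    by (rule lefschetz_reduce_pair)
  define P :: "('a \<Rightarrow>\<^sub>0 real) \<Rightarrow> ('a \<Rightarrow>\<^sub>0 real)"
    where "P x = x - Poly_Mapping.lookup x \<mu> *\<^sub>R Poly_Mapping.single \<mu> 1" for x
  \<comment> \<open>the coefficient at \<open>\<kappa>\<close> of the boundary of \<open>x\<close>\<close>
  define \<phi> where "\<phi> x = (\<Sum>\<sigma>\<in>kcells K (cdim K \<mu>). Poly_Mapping.lookup x \<sigma> * inc K \<sigma> \<kappa>)"
    for x :: "'a \<Rightarrow>\<^sub>0 real"
  let ?S = "cell_boundary K ` kcells K ?d"
  have "kcells ?L ?d = kcells K ?d"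
    using dim_mu by (auto simp: kcells_def)
  moreover have "cell_boundary ?L \<tau> = P (cell_boundary K \<tau>)" if "\<tau> \<in> kcells K ?d" for \<tau>
    using that inc_eq_0[of \<tau> \<kappa>] kappa dim_mu
    by (intro poly_mapping_eqI)
      (auto simp: P_def lookup_linear lookup_cell_boundary L.lookup_cell_boundary mem_kcells)
  ultimately have "cell_boundary ?L ` kcells ?L ?d = P ` ?S"
    by (auto simp: image_image)
  moreover have "dim (P ` ?S) = dim ?S"
  proof (rule dim_image_inj_on_span)
    show "linear P"
      by (rule linearI) (simp_all add: P_def lookup_linear algebra_simps)
    show "finite ?S"
      using finite_kcells by blast
    fix x
    assume x: "x \<in> span ?S" and "P x = 0"
    define c where "c = Poly_Mapping.lookup x \<mu>"
    have xc: "x = c *\<^sub>R Poly_Mapping.single \<mu> 1"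
      using \<open>P x = 0\<close> by (simp add: P_def c_def)
    have "\<phi> x = 0"
      using x
    proof (rule span_induct)
      show "subspace {x. \<phi> x = 0}"
        unfolding subspace_def \<phi>_def
        by (simp add: lookup_linear distrib_right sum.distrib mult.assoc sum_distrib_left[symmetric])
      have "\<phi> (cell_boundary K \<tau>) = (\<Sum>\<sigma>\<in>kcells K (cdim K \<mu>). inc K \<tau> \<sigma> * inc K \<sigma> \<kappa>)"
        if "\<tau> \<in> kcells K ?d" for \<tau>
        unfolding \<phi>_def using that by (intro sum.cong) (auto simp: lookup_cell_boundary mem_kcells)
      then show "\<And>y. y \<in> ?S \<Longrightarrow> \<phi> y = 0"
        using inc_inc_kcells kappa by (auto simp: mem_kcells)
    qed
    moreover have "\<phi> x = (\<Sum>\<sigma>\<in>kcells K (cdim K \<mu>). if \<mu> = \<sigma> then c * inc K \<sigma> \<kappa> else 0)"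
      unfolding \<phi>_def xc by (intro sum.cong) (auto simp: lookup_linear)
    ultimately have "c * inc K \<mu> \<kappa> = 0"
      using finite_kcells mu by (simp add: mem_kcells)
    then show "x = 0"
      using xc incident by simp
  qed
  ultimately show ?thesis
    by (simp add: boundary_rank_def)
qed

text \<open>
  One dimension down, the reduction drops the boundary of \<open>\<kappa>\<close>.  The boundary of \<open>\<mu>\<close> is a cycle in
  which \<open>\<kappa>\<close> has a nonzero coefficient, so the boundary of \<open>\<kappa>\<close> is a combination of the remaining ones.
\<close>

lemma boundary_rank_reduce_pair_below:
  "boundary_rank (reduce_pair K \<mu> \<kappa>) (cdim K \<kappa>) = boundary_rank K (cdim K \<kappa>)"
proof -
  let ?L = "reduce_pair K \<mu> \<kappa>" and ?d = "cdim K \<kappa>"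
  interpret L: lefschetz_complex ?L
    by (rule lefschetz_reduce_pair)
  let ?v = "cell_boundary K"
  let ?S = "?v ` (kcells K ?d - {\<kappa>})"
  have "kcells ?L ?d = kcells K ?d - {\<kappa>}"
    using dim_mu by (auto simp: kcells_def)
  moreover have "cell_boundary ?L \<tau> = ?v \<tau>" if "\<tau> \<in> kcells K ?d" for \<tau>
    using that inc_eq_0[of \<tau> \<kappa>] kappa dim_mu
    by (intro poly_mapping_eqI)
      (auto simp: lookup_cell_boundary L.lookup_cell_boundary mem_kcells)
  ultimately have 1: "cell_boundary ?L ` kcells ?L ?d = ?S"
    by auto
  have k: "\<kappa> \<in> kcells K ?d"
    using kappa by (simp add: mem_kcells)
  have "boundary K ?d (cell_boundary K \<mu>) = (\<Sum>\<sigma>\<in>kcells K ?d. inc K \<mu> \<sigma> *\<^sub>R ?v \<sigma>)"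
    unfolding boundary_def using dim_mu by (intro sum.cong) (auto simp: lookup_cell_boundary mem_kcells)
  then have "0 = inc K \<mu> \<kappa> *\<^sub>R ?v \<kappa> + (\<Sum>\<sigma>\<in>kcells K ?d - {\<kappa>}. inc K \<mu> \<sigma> *\<^sub>R ?v \<sigma>)"
    using boundary_boundary[OF mu] sum.remove[OF finite_kcells k] by metis
  then have "inc K \<mu> \<kappa> *\<^sub>R ?v \<kappa> = - (\<Sum>\<sigma>\<in>kcells K ?d - {\<kappa>}. inc K \<mu> \<sigma> *\<^sub>R ?v \<sigma>)"
    by (simp add: eq_neg_iff_add_eq_0)
  also have "\<dots> \<in> span ?S"
    by (intro span_neg span_sum span_scale span_base) auto
  finally have "inverse (inc K \<mu> \<kappa>) *\<^sub>R inc K \<mu> \<kappa> *\<^sub>R ?v \<kappa> \<in> span ?S"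
    by (rule span_scale)
  then have "?v \<kappa> \<in> span ?S"
    using incident by simp
  then have "span (insert (?v \<kappa>) ?S) = span ?S"
    by (rule span_redundant)
  moreover have "insert (?v \<kappa>) ?S = ?v ` kcells K ?d"
    using k by auto
  ultimately show ?thesis
    unfolding boundary_rank_def 1 by (metis span_eq_dim)
qed

lemma boundary_rank_reduce_pair_other:
  assumes "k \<noteq> cdim K \<kappa>" "k \<noteq> cdim K \<mu>" "k \<noteq> Suc (cdim K \<mu>)"
  shows "boundary_rank (reduce_pair K \<mu> \<kappa>) k = boundary_rank K k"
proof -
  let ?L = "reduce_pair K \<mu> \<kappa>"
  interpret L: lefschetz_complex ?L
    by (rule lefschetz_reduce_pair)
  have "kcells ?L k = kcells K k"
    using assms by (auto simp: kcells_def)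
  moreover have "cell_boundary ?L \<tau> = cell_boundary K \<tau>" if "\<tau> \<in> kcells K k" for \<tau>
    using that inc_eq_0[of \<tau> \<kappa>] kappa dim_mu assms
    by (intro poly_mapping_eqI)
      (auto simp: lookup_cell_boundary L.lookup_cell_boundary mem_kcells)
  ultimately show ?thesis
    by (simp add: boundary_rank_def)
qed

lemma boundary_rank_reduce_pair:
  "boundary_rank K k = boundary_rank (reduce_pair K \<mu> \<kappa>) k + (if k = cdim K \<mu> then 1 else 0)"
  using boundary_rank_reduce_pair_top boundary_rank_reduce_pair_above
    boundary_rank_reduce_pair_below boundary_rank_reduce_pair_other[of k]
  by (cases "k = cdim K \<kappa> \<or> k = Suc (cdim K \<mu>)") (auto simp: dim_mu)

text \<open>
  Two neighbouring dimensions lose one cell each, and the rank of the boundary map between them drops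
  by one; in both dimensions the two changes cancel.
\<close>

lemma betti_reduce_pair: "betti (reduce_pair K \<mu> \<kappa>) k = betti K k"
proof -
  let ?L = "reduce_pair K \<mu> \<kappa>"
  interpret L: lefschetz_complex ?L
    by (rule lefschetz_reduce_pair)
  have "card (kcells K k) = card (kcells ?L k) + card (kcells K k \<inter> {\<mu>, \<kappa>})"
    unfolding kcells_reduce_pair using card_Int_Diff[OF finite_kcells[of k], of "{\<mu>, \<kappa>}"] by simp
  moreover have "kcells K k \<inter> {\<mu>, \<kappa>} = (if k = cdim K \<mu> then {\<mu>} else if k = cdim K \<kappa> then {\<kappa>} else {})"
    using dim_mu mu kappa by (auto simp: mem_kcells)
  ultimately show ?thesis
    using betti_eq[of k] L.betti_eq[of k] boundary_rank_reduce_pair[of k]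
      boundary_rank_reduce_pair[of "Suc k"] dim_mu by (auto split: if_splits)
qed

end

text \<open>
  An isolated cell contributes a zero row and a zero column to the boundary matrices.  With \<open>A = {}\<close>
  this says that the incidence functions matter on the cells only, so that complexes given by
  different records can be compared.
\<close>

lemma boundary_rank_remove_isolated:
  assumes "lefschetz_complex K" "lefschetz_complex L" "cells L = cells K - A" "cdim L = cdim K"
    and "\<And>\<tau> \<sigma>. \<lbrakk>\<tau> \<in> cells L; \<sigma> \<in> cells L\<rbrakk> \<Longrightarrow> inc L \<tau> \<sigma> = inc K \<tau> \<sigma>"
    and "\<And>\<eta>. \<lbrakk>\<eta> \<in> A; \<eta> \<in> cells K\<rbrakk> \<Longrightarrow> isolated K \<eta>"
  shows "boundary_rank L k = boundary_rank K k"
proof -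
  interpret K: lefschetz_complex K by fact
  interpret L: lefschetz_complex L by fact
  have L: "cell_boundary L \<tau> = cell_boundary K \<tau>" if "\<tau> \<in> kcells L k" for \<tau>
    using that assms(3-6)
    by (intro poly_mapping_eqI)
      (auto simp: K.lookup_cell_boundary L.lookup_cell_boundary mem_kcells isolated_def)
  have A: "cell_boundary K \<eta> = 0" if "\<eta> \<in> A" "\<eta> \<in> cells K" for \<eta>
    using that assms(6)
    by (intro poly_mapping_eqI) (auto simp: K.lookup_cell_boundary isolated_def)
  have "cell_boundary L ` kcells L k - {0} = cell_boundary K ` kcells K k - {0}"
    using L A assms(3,4) by (force simp: mem_kcells)
  then show ?thesis
    unfolding boundary_rank_def by (metis span_delete_0 span_eq_dim)
qed

section \<open>Pairs reversed by a discrete Morse-Bott function\<close>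

definition reversed :: "'a lefschetz \<Rightarrow> ('a \<Rightarrow> real) \<Rightarrow> 'a \<Rightarrow> 'a \<Rightarrow> bool" where
  "reversed K f \<tau> \<sigma> \<longleftrightarrow> inc K \<tau> \<sigma> \<noteq> 0 \<and> f \<tau> < f \<sigma>"

lemma up_cells_reversed: "up_cells K f \<sigma> = {\<tau> \<in> cells K. reversed K f \<tau> \<sigma>}"
  and down_cells_reversed: "down_cells K f \<sigma> = {\<nu> \<in> cells K. reversed K f \<sigma> \<nu>}"
  by (auto simp: up_cells_def down_cells_def reversed_def)

lemma weakly_critical_complex_simps [simp]:
  "cells (weakly_critical_complex K f) = {\<sigma>. weakly_critical K f \<sigma>}"
  "cdim (weakly_critical_complex K f) = cdim K"
  "inc (weakly_critical_complex K f) \<tau> \<sigma> = (if f \<tau> = f \<sigma> then inc K \<tau> \<sigma> else 0)"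
  by (simp_all add: weakly_critical_complex_def)

lemma weakly_critical_cell: "weakly_critical K f \<sigma> \<Longrightarrow> \<sigma> \<in> cells K"
  by (simp add: weakly_critical_def)

lemma kcells_weakly_critical_complex:
  "kcells (weakly_critical_complex K f) k \<subseteq> kcells K k"
  by (auto simp: kcells_def weakly_critical_def)

context lefschetz_complex
begin

text \<open>
  A vanishing sum cannot have exactly one nonzero summand.  In this form the second incidence axiom
  restricts the position of reversed pairs.
\<close>

lemma other_intermediate_cell:
  assumes "\<tau> \<in> cells K" "\<sigma> \<in> cells K" "\<nu> \<in> cells K" "inc K \<tau> \<sigma> \<noteq> 0" "inc K \<sigma> \<nu> \<noteq> 0"
  obtains \<sigma>' where "\<sigma>' \<in> cells K" "\<sigma>' \<noteq> \<sigma>" "inc K \<tau> \<sigma>' \<noteq> 0" "inc K \<sigma>' \<nu> \<noteq> 0"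
proof -
  have \<sigma>: "\<sigma> \<in> kcells K (cdim K \<sigma>)"
    using assms by (simp add: mem_kcells)
  have "(\<Sum>\<rho>\<in>kcells K (cdim K \<sigma>) - {\<sigma>}. inc K \<tau> \<rho> * inc K \<rho> \<nu>) \<noteq> 0"
    using inc_inc_kcells[OF assms(1,3)] sum.remove[OF finite_kcells \<sigma>] assms(4,5)
    by (metis add.right_neutral mult_eq_0_iff)
  then obtain \<rho> where "\<rho> \<in> kcells K (cdim K \<sigma>) - {\<sigma>}" "inc K \<tau> \<rho> * inc K \<rho> \<nu> \<noteq> 0"
    by (meson sum.neutral)
  then show thesis
    using that by (auto simp: mem_kcells)
qed

lemma finite_up_cells: "\<sigma> \<in> cells K \<Longrightarrow> finite (up_cells K f \<sigma>)"
  using finite_kcells[of "Suc (cdim K \<sigma>)"]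
  by (rule finite_subset[rotated]) (auto simp: up_cells_def mem_kcells dest: inc_nonzero_dim)

lemma finite_down_cells: "\<sigma> \<in> cells K \<Longrightarrow> finite (down_cells K f \<sigma>)"
  using finite_kcells[of "cdim K \<sigma> - 1"]
  by (rule finite_subset[rotated]) (auto simp: down_cells_def mem_kcells dest: inc_nonzero_dim)

lemma U_snc_eq_0: "\<sigma> \<in> cells K \<Longrightarrow> U_snc K f \<sigma> = 0 \<longleftrightarrow> (\<forall>\<tau>\<in>cells K. \<not> reversed K f \<tau> \<sigma>)"
  using finite_up_cells[of \<sigma> f] by (auto simp: U_snc_def up_cells_reversed)

lemma D_snc_eq_0: "\<sigma> \<in> cells K \<Longrightarrow> D_snc K f \<sigma> = 0 \<longleftrightarrow> (\<forall>\<nu>\<in>cells K. \<not> reversed K f \<sigma> \<nu>)"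
  using finite_down_cells[of \<sigma> f] by (auto simp: D_snc_def down_cells_reversed)

lemma weakly_critical_iff:
  "weakly_critical K f \<sigma> \<longleftrightarrow>
     \<sigma> \<in> cells K \<and> (\<forall>\<tau>\<in>cells K. \<not> reversed K f \<tau> \<sigma> \<and> \<not> reversed K f \<sigma> \<tau>)"
  using U_snc_eq_0 D_snc_eq_0 by (auto simp: weakly_critical_def)

lemma weakly_critical_le_up:
  "\<lbrakk>weakly_critical K f \<sigma>; \<tau> \<in> cells K; inc K \<tau> \<sigma> \<noteq> 0\<rbrakk> \<Longrightarrow> f \<sigma> \<le> f \<tau>"
  unfolding weakly_critical_iff reversed_def by (metis not_less)

lemma weakly_critical_ge_down:
  "\<lbrakk>weakly_critical K f \<sigma>; \<nu> \<in> cells K; inc K \<sigma> \<nu> \<noteq> 0\<rbrakk> \<Longrightarrow> f \<nu> \<le> f \<sigma>"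
  unfolding weakly_critical_iff reversed_def by (metis not_less)

end

locale morse_bott = lefschetz_complex K for K :: "'a lefschetz" +
  fixes f :: "'a \<Rightarrow> real"
  assumes morse_bott: "discrete_morse_bott K f"
begin

abbreviation W :: "'a lefschetz" where "W \<equiv> weakly_critical_complex K f"

lemma reversed_up_unique:
  assumes "\<tau> \<in> cells K" "\<tau>' \<in> cells K" "\<sigma> \<in> cells K" "reversed K f \<tau> \<sigma>" "reversed K f \<tau>' \<sigma>"
  shows "\<tau> = \<tau>'"
proof -
  have "card (up_cells K f \<sigma>) \<le> Suc 0"
    using morse_bott assms(3) by (simp add: discrete_morse_bott_def U_snc_def)
  then show ?thesis
    using finite_up_cells[OF assms(3), of f] assms by (auto simp: card_le_Suc0_iff_eq up_cells_reversed)
qed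

lemma reversed_down_unique:
  assumes "\<sigma> \<in> cells K" "\<nu> \<in> cells K" "\<nu>' \<in> cells K" "reversed K f \<sigma> \<nu>" "reversed K f \<sigma> \<nu>'"
  shows "\<nu> = \<nu>'"
proof -
  have "card (down_cells K f \<sigma>) \<le> Suc 0"
    using morse_bott assms(1) by (simp add: discrete_morse_bott_def D_snc_def)
  then show ?thesis
    using finite_down_cells[OF assms(1), of f] assms by (auto simp: card_le_Suc0_iff_eq down_cells_reversed)
qed

lemma reversed_top_le:
  assumes "\<tau> \<in> cells K" "\<sigma> \<in> cells K" "\<sigma>' \<in> cells K" "reversed K f \<tau> \<sigma>" "\<sigma>' \<noteq> \<sigma>" "inc K \<tau> \<sigma>' \<noteq> 0"
  shows "f \<sigma>' \<le> f \<tau>"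
  using reversed_down_unique[of \<tau> \<sigma> \<sigma>'] assms unfolding reversed_def by (metis not_less)

lemma reversed_bottom_le:
  assumes "\<tau> \<in> cells K" "\<sigma> \<in> cells K" "\<tau>' \<in> cells K" "reversed K f \<tau> \<sigma>" "\<tau>' \<noteq> \<tau>" "inc K \<tau>' \<sigma> \<noteq> 0"
  shows "f \<sigma> \<le> f \<tau>'"
  using reversed_up_unique[of \<tau> \<tau>' \<sigma>] assms unfolding reversed_def by (metis not_less)

text \<open>
  If \<open>f \<tau> < f \<sigma> < f \<nu>\<close> along \<open>\<tau>, \<sigma>, \<nu>\<close>, another cell \<open>\<sigma>'\<close> between \<open>\<tau>\<close> and \<open>\<nu>\<close> would have to satisfy
  \<open>f \<nu> \<le> f \<sigma>' \<le> f \<tau>\<close>, since \<open>\<tau>\<close> and \<open>\<nu>\<close> each allow one exception only and \<open>\<sigma>\<close> uses it up.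
\<close>

lemma not_reversed_twice:
  assumes "\<tau> \<in> cells K" "\<sigma> \<in> cells K" "\<nu> \<in> cells K" "reversed K f \<tau> \<sigma>"
  shows "\<not> reversed K f \<sigma> \<nu>"
proof
  assume rev: "reversed K f \<sigma> \<nu>"
  obtain \<sigma>' where \<sigma>': "\<sigma>' \<in> cells K" "\<sigma>' \<noteq> \<sigma>" "inc K \<tau> \<sigma>' \<noteq> 0" "inc K \<sigma>' \<nu> \<noteq> 0"
    using other_intermediate_cell[of \<tau> \<sigma> \<nu>] assms rev unfolding reversed_def by blast
  have "f \<sigma>' \<le> f \<tau>"
    using reversed_top_le assms \<sigma>' by blast
  moreover have "f \<nu> \<le> f \<sigma>'"
    using reversed_bottom_le[of \<sigma> \<nu> \<sigma>'] assms rev \<sigma>' by blast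
  ultimately show False
    using assms(4) rev by (simp add: reversed_def)
qed

text \<open>
  This makes the incidence sums of \<open>W\<close> coincide with those of \<open>K\<close>.  The levels along \<open>\<tau>, \<sigma>, \<nu>\<close>
  descend weakly and have equal ends.  If \<open>\<sigma>\<close> were in a reversed pair with some \<open>\<alpha>\<close>, a further cell
  \<open>\<sigma>'\<close> between \<open>\<alpha>\<close> and \<open>\<nu>\<close> (or between \<open>\<tau>\<close> and \<open>\<alpha>\<close>) would form a reversed pair with \<open>\<nu>\<close> (or \<open>\<tau>\<close>).
\<close>

lemma weakly_critical_between:
  assumes "weakly_critical K f \<tau>" "weakly_critical K f \<nu>" "f \<tau> = f \<nu>" "\<sigma> \<in> cells K"
    and "inc K \<tau> \<sigma> \<noteq> 0" "inc K \<sigma> \<nu> \<noteq> 0"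
  shows "weakly_critical K f \<sigma> \<and> f \<sigma> = f \<tau>"
proof -
  have \<tau>: "\<tau> \<in> cells K" and \<nu>: "\<nu> \<in> cells K"
    using assms(1,2) weakly_critical_cell[of K f] by blast+
  have f: "f \<sigma> = f \<tau>"
    using weakly_critical_ge_down[OF assms(1,4,5)] weakly_critical_le_up[OF assms(2,4,6)] assms(3)
    by simp
  moreover have "\<not> reversed K f \<alpha> \<sigma>" if \<alpha>: "\<alpha> \<in> cells K" for \<alpha>
  proof
    assume rev: "reversed K f \<alpha> \<sigma>"
    then obtain \<sigma>' where \<sigma>': "\<sigma>' \<in> cells K" "\<sigma>' \<noteq> \<sigma>" "inc K \<alpha> \<sigma>' \<noteq> 0" "inc K \<sigma>' \<nu> \<noteq> 0"
      using other_intermediate_cell[of \<alpha> \<sigma> \<nu>] \<alpha> assms \<nu> unfolding reversed_def by blast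
    then have "f \<sigma>' < f \<nu>"
      using reversed_top_le[of \<alpha> \<sigma> \<sigma>'] \<alpha> rev f assms(3,4) by (simp add: reversed_def)
    then show False
      using weakly_critical_le_up[of f \<nu> \<sigma>'] assms(2) \<sigma>' by simp
  qed
  moreover have "\<not> reversed K f \<sigma> \<beta>" if \<beta>: "\<beta> \<in> cells K" for \<beta>
  proof
    assume rev: "reversed K f \<sigma> \<beta>"
    then obtain \<sigma>' where \<sigma>': "\<sigma>' \<in> cells K" "\<sigma>' \<noteq> \<sigma>" "inc K \<tau> \<sigma>' \<noteq> 0" "inc K \<sigma>' \<beta> \<noteq> 0"
      using other_intermediate_cell[of \<tau> \<sigma> \<beta>] \<beta> assms \<tau> unfolding reversed_def by blast
    then have "f \<tau> < f \<sigma>'"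
      using reversed_bottom_le[of \<sigma> \<beta> \<sigma>'] \<beta> rev f assms(4) by (simp add: reversed_def)
    then show False
      using weakly_critical_ge_down[of f \<tau> \<sigma>'] assms(1) \<sigma>' by simp
  qed
  ultimately show ?thesis
    using weakly_critical_iff assms(4) by blast
qed

lemma lefschetz_W: "lefschetz_complex W"
proof
  show "finite (kcells W k)" for k
    using finite_subset[OF kcells_weakly_critical_complex finite_kcells] .
  show "int (cdim W \<tau>) - int (cdim W \<sigma>) = 1"
    if "\<tau> \<in> cells W" "\<sigma> \<in> cells W" "inc W \<tau> \<sigma> \<noteq> 0" for \<tau> \<sigma>
    using that inc_dim[of \<tau> \<sigma>] weakly_critical_cell[of K f] by (auto split: if_splits)
  show "(\<Sum>\<sigma> | \<sigma> \<in> cells W \<and> inc W \<tau> \<sigma> * inc W \<sigma> \<nu> \<noteq> 0. inc W \<tau> \<sigma> * inc W \<sigma> \<nu>) = 0"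
    if \<tau>\<nu>: "\<tau> \<in> cells W" "\<nu> \<in> cells W" for \<tau> \<nu>
  proof (cases "f \<tau> = f \<nu>")
    case True
    have cells: "\<tau> \<in> cells K" "\<nu> \<in> cells K"
      using \<tau>\<nu> weakly_critical_cell[of K f] by auto
    have wc: "weakly_critical K f \<tau>" "weakly_critical K f \<nu>"
      using \<tau>\<nu> by auto
    have between: "weakly_critical K f \<sigma> \<and> f \<sigma> = f \<tau>"
      if "\<sigma> \<in> cells K" "inc K \<tau> \<sigma> * inc K \<sigma> \<nu> \<noteq> 0" for \<sigma>
      using weakly_critical_between[OF wc True that(1)] that(2) by simp
    have prod: "inc W \<tau> \<sigma> * inc W \<sigma> \<nu> = inc K \<tau> \<sigma> * inc K \<sigma> \<nu>" if "\<sigma> \<in> cells K" for \<sigma>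
      using between[OF that] True by auto
    have "{\<sigma> \<in> cells W. inc W \<tau> \<sigma> * inc W \<sigma> \<nu> \<noteq> 0} = {\<sigma> \<in> cells K. inc K \<tau> \<sigma> * inc K \<sigma> \<nu> \<noteq> 0}"
    proof (intro Collect_cong iffI conjI)
      fix \<sigma>
      assume "\<sigma> \<in> cells W \<and> inc W \<tau> \<sigma> * inc W \<sigma> \<nu> \<noteq> 0"
      then show "\<sigma> \<in> cells K" "inc K \<tau> \<sigma> * inc K \<sigma> \<nu> \<noteq> 0"
        using weakly_critical_cell[of K f \<sigma>] by (auto split: if_splits)
    next
      fix \<sigma>
      assume "\<sigma> \<in> cells K \<and> inc K \<tau> \<sigma> * inc K \<sigma> \<nu> \<noteq> 0"
      then show "\<sigma> \<in> cells W" "inc W \<tau> \<sigma> * inc W \<sigma> \<nu> \<noteq> 0"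
        using between prod by (auto simp del: weakly_critical_complex_simps(3))
    qed
    then have "(\<Sum>\<sigma> | \<sigma> \<in> cells W \<and> inc W \<tau> \<sigma> * inc W \<sigma> \<nu> \<noteq> 0. inc W \<tau> \<sigma> * inc W \<sigma> \<nu>)
        = (\<Sum>\<sigma> | \<sigma> \<in> cells K \<and> inc K \<tau> \<sigma> * inc K \<sigma> \<nu> \<noteq> 0. inc K \<tau> \<sigma> * inc K \<sigma> \<nu>)"
      using prod by (intro sum.cong) (simp_all del: weakly_critical_complex_simps)
    then show ?thesis
      using inc_inc cells by simp
  next
    case False
    then show ?thesis
      by (intro sum.neutral) auto
  qed
qed

end

section \<open>The excess and its behaviour under a change of complex\<close>

text \<open>
  The coefficient of \<open>t\<^sup>k\<close> in \<open>R\<^sub>t\<close>, as an integer.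
\<close>

definition excess :: "'a lefschetz \<Rightarrow> ('a \<Rightarrow> real) \<Rightarrow> nat \<Rightarrow> int" where
  "excess K f k = int (dim (boundaries K k)) - int (d_snc K f (Suc k))
     - int (dim (boundaries (weakly_critical_complex K f) k))"

lemma R_series_nth: "fps_nth (R_series K f) k = of_int (excess K f k)"
  by (simp add: R_series_def excess_def)

lemma (in morse_bott) excess_eq:
  "excess K f k = int (boundary_rank K (Suc k)) - int (d_snc K f (Suc k)) - int (boundary_rank W (Suc k))"
  by (simp add: excess_def dim_boundaries lefschetz_complex.dim_boundaries[OF lefschetz_W])

text \<open>
  All moves have this in common: the reversed pairs among the surviving cells stay the same, and no
  survivor forms a reversed pair with a removed cell.  Hence \<open>U\<close>, \<open>D\<close> and weak criticality of the
  survivors do not change, whatever happens to the incidence numbers of unreversed pairs.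
\<close>

definition keeps_reversals ::
    "'a lefschetz \<Rightarrow> ('a \<Rightarrow> real) \<Rightarrow> 'a lefschetz \<Rightarrow> ('a \<Rightarrow> real) \<Rightarrow> bool" where
  "keeps_reversals K f L g \<longleftrightarrow> cells L \<subseteq> cells K \<and> cdim L = cdim K \<and>
     (\<forall>\<tau>\<in>cells K - cells L. \<forall>\<sigma>\<in>cells L. \<not> reversed K f \<tau> \<sigma> \<and> \<not> reversed K f \<sigma> \<tau>) \<and>
     (\<forall>\<tau>\<in>cells L. \<forall>\<sigma>\<in>cells L. reversed L g \<tau> \<sigma> \<longleftrightarrow> reversed K f \<tau> \<sigma>)"

lemma keeps_reversals_cells:
  assumes "keeps_reversals K f L g" "\<sigma> \<in> cells L"
  shows "up_cells L g \<sigma> = up_cells K f \<sigma>" "down_cells L g \<sigma> = down_cells K f \<sigma>"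
  using assms unfolding keeps_reversals_def up_cells_reversed down_cells_reversed by blast+

lemma keeps_reversals_snc:
  assumes "keeps_reversals K f L g" "\<sigma> \<in> cells L"
  shows "U_snc L g \<sigma> = U_snc K f \<sigma>" "D_snc L g \<sigma> = D_snc K f \<sigma>"
  using keeps_reversals_cells[OF assms] by (simp_all add: U_snc_def D_snc_def)

lemma keeps_reversals_subset: "keeps_reversals K f L g \<Longrightarrow> \<sigma> \<in> cells L \<Longrightarrow> \<sigma> \<in> cells K"
  by (auto simp: keeps_reversals_def)

lemma keeps_reversals_morse_bott:
  "keeps_reversals K f L g \<Longrightarrow> discrete_morse_bott K f \<Longrightarrow> discrete_morse_bott L g"
  by (simp add: discrete_morse_bott_def keeps_reversals_snc keeps_reversals_subset)

lemma keeps_reversals_weakly_critical: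
  "keeps_reversals K f L g \<Longrightarrow> weakly_critical L g \<sigma> \<longleftrightarrow> \<sigma> \<in> cells L \<and> weakly_critical K f \<sigma>"
  by (auto simp: weakly_critical_def keeps_reversals_snc keeps_reversals_subset)

lemma keeps_reversals_d_snc:
  assumes "keeps_reversals K f L g" "finite (kcells K k)"
  shows "d_snc K f k = d_snc L g k + card {\<sigma> \<in> kcells K k - cells L. D_snc K f \<sigma> = 1}"
proof -
  let ?A = "{\<sigma> \<in> kcells L k. D_snc L g \<sigma> = 1}"
  let ?B = "{\<sigma> \<in> kcells K k - cells L. D_snc K f \<sigma> = 1}"
  have "kcells L k \<subseteq> kcells K k"
    using assms(1) by (auto simp: mem_kcells keeps_reversals_def)
  then have "finite (kcells L k)"
    using assms(2) finite_subset by blast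
  then have "finite ?A" "finite ?B"
    using assms(2) by auto
  moreover have "?A \<inter> ?B = {}"
    by (auto simp: mem_kcells)
  moreover have "{\<sigma> \<in> kcells K k. D_snc K f \<sigma> = 1} = ?A \<union> ?B"
    using assms keeps_reversals_snc[OF assms(1)] by (auto simp: mem_kcells keeps_reversals_def)
  ultimately show ?thesis
    unfolding d_snc_def by (simp only: card_Un_disjoint)
qed

lemma keeps_reversals_d_snc_eq:
  assumes "keeps_reversals K f L g" "finite (kcells K k)"
    and "\<And>\<sigma>. \<lbrakk>\<sigma> \<in> cells K; \<sigma> \<notin> cells L\<rbrakk> \<Longrightarrow> D_snc K f \<sigma> = 0"
  shows "d_snc L g k = d_snc K f k"
proof -
  have "{\<sigma> \<in> kcells K k - cells L. D_snc K f \<sigma> = 1} = {}"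
    using assms(3) by (auto simp: mem_kcells)
  then show ?thesis
    using keeps_reversals_d_snc[OF assms(1,2)] by (metis add.right_neutral card.empty)
qed

section \<open>Effect of the moves on the excess\<close>

context morse_bott
begin

lemma incident_pairI:
  "\<lbrakk>\<tau> \<in> cells K; \<sigma> \<in> cells K; inc K \<tau> \<sigma> \<noteq> 0\<rbrakk> \<Longrightarrow> incident_pair K \<tau> \<sigma>"
  by unfold_locales

text \<open>
  An incidence number at \<open>(\<alpha>, \<beta>)\<close> changes only if \<open>\<alpha>\<close> is incident to \<open>\<sigma>\<close> and \<open>\<tau>\<close> to \<open>\<beta>\<close>.  As the
  exceptions that \<open>\<sigma>\<close> and \<open>\<tau>\<close> allow are used up by the pair itself, then
  \<open>f \<beta> \<le> f \<tau> < f \<sigma> \<le> f \<alpha>\<close>.  Such pairs are neither reversed nor level, so neither the reversed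
  pairs nor \<open>W\<close> notice the change.
\<close>

lemma keeps_reversals_reduce_reversed:
  assumes "\<tau> \<in> cells K" "\<sigma> \<in> cells K" "reversed K f \<tau> \<sigma>"
  shows "keeps_reversals K f (reduce_pair K \<tau> \<sigma>) f"
    and "\<lbrakk>\<alpha> \<in> cells (reduce_pair K \<tau> \<sigma>); \<beta> \<in> cells (reduce_pair K \<tau> \<sigma>); f \<alpha> \<le> f \<beta>\<rbrakk>
           \<Longrightarrow> inc (reduce_pair K \<tau> \<sigma>) \<alpha> \<beta> = inc K \<alpha> \<beta>"
proof -
  let ?L = "reduce_pair K \<tau> \<sigma>"
  show inc: "inc ?L \<alpha> \<beta> = inc K \<alpha> \<beta>" if "\<alpha> \<in> cells ?L" "\<beta> \<in> cells ?L" "f \<alpha> \<le> f \<beta>" for \<alpha> \<beta>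
  proof (rule ccontr)
    assume "inc ?L \<alpha> \<beta> \<noteq> inc K \<alpha> \<beta>"
    then have "inc K \<alpha> \<sigma> \<noteq> 0" "inc K \<tau> \<beta> \<noteq> 0"
      by auto
    then have "f \<sigma> \<le> f \<alpha>" "f \<beta> \<le> f \<tau>"
      using reversed_bottom_le[of \<tau> \<sigma> \<alpha>] reversed_top_le[of \<tau> \<sigma> \<beta>] assms that by auto
    then show False
      using that assms(3) by (simp add: reversed_def)
  qed
  have "reversed ?L f \<alpha> \<beta> \<longleftrightarrow> reversed K f \<alpha> \<beta>" if "\<alpha> \<in> cells ?L" "\<beta> \<in> cells ?L" for \<alpha> \<beta>
    using inc[OF that] unfolding reversed_def by auto
  moreover have "\<not> reversed K f \<alpha> \<beta>" "\<not> reversed K f \<beta> \<alpha>"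
    if "\<alpha> = \<tau> \<or> \<alpha> = \<sigma>" "\<beta> \<in> cells ?L" for \<alpha> \<beta>
    using that assms reversed_up_unique[of \<tau> \<beta> \<sigma>] reversed_down_unique[of \<tau> \<sigma> \<beta>]
      not_reversed_twice[of \<beta> \<tau> \<sigma>] not_reversed_twice[of \<tau> \<sigma> \<beta>] by auto
  ultimately show "keeps_reversals K f ?L f"
    unfolding keeps_reversals_def by auto
qed

text \<open>
  The rank and the number of cells with \<open>D = 1\<close> drop together, and \<open>W\<close> stays the same.
\<close>

lemma excess_reduce_reversed:
  assumes "\<tau> \<in> cells K" "\<sigma> \<in> cells K" "reversed K f \<tau> \<sigma>"
  shows "excess (reduce_pair K \<tau> \<sigma>) f k = excess K f k"
proof -
  let ?L = "reduce_pair K \<tau> \<sigma>"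
  note keeps = keeps_reversals_reduce_reversed(1)[OF assms]
  interpret P: incident_pair K \<tau> \<sigma>
    using assms by (intro incident_pairI) (auto simp: reversed_def)
  interpret L: morse_bott ?L f
    by (intro morse_bott.intro morse_bott_axioms.intro P.lefschetz_reduce_pair
        keeps_reversals_morse_bott[OF keeps] morse_bott)
  have "boundary_rank L.W (Suc k) = boundary_rank W (Suc k)"
  proof (rule boundary_rank_remove_isolated[where A = "{}"])
    have "\<not> weakly_critical K f \<tau>" "\<not> weakly_critical K f \<sigma>"
      using assms weakly_critical_iff by blast+
    then show "cells L.W = cells W - {}"
      using keeps_reversals_weakly_critical[OF keeps] weakly_critical_cell[of K f] by auto
    show "inc L.W \<alpha> \<beta> = inc W \<alpha> \<beta>" if "\<alpha> \<in> cells L.W" "\<beta> \<in> cells L.W" for \<alpha> \<beta>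
      using that keeps_reversals_reduce_reversed(2)[OF assms, of \<alpha> \<beta>]
        weakly_critical_cell[of ?L f] by (auto simp del: reduce_pair_simps(3))
  qed (use L.lefschetz_W lefschetz_W in auto)
  moreover have "D_snc K f \<tau> = 1" "D_snc K f \<sigma> = 0"
    using assms D_snc_eq_0[of \<sigma> f] D_snc_eq_0[of \<tau> f] not_reversed_twice[of \<tau> \<sigma>] morse_bott
    by (auto simp: discrete_morse_bott_def le_Suc_eq)
  then have "{\<rho> \<in> kcells K (Suc k) - cells ?L. D_snc K f \<rho> = 1} = (if Suc k = cdim K \<tau> then {\<tau>} else {})"
    using assms(1) by (auto simp: mem_kcells)
  then have "d_snc K f (Suc k) = d_snc ?L f (Suc k) + (if Suc k = cdim K \<tau> then 1 else 0)"
    using keeps_reversals_d_snc[OF keeps finite_kcells, of "Suc k"] by auto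
  ultimately show ?thesis
    using P.boundary_rank_reduce_pair[of "Suc k"] by (simp add: excess_eq L.excess_eq)
qed

text \<open>
  By the last hypothesis, every pair whose incidence number changes descends weakly and is therefore
  not reversed, before or after the change.
\<close>

lemma keeps_reversals_reduce_critical:
  assumes "weakly_critical K f \<tau>" "weakly_critical K f \<sigma>" "inc K \<tau> \<sigma> \<noteq> 0"
    and "\<And>\<alpha> \<beta>. \<lbrakk>\<alpha> \<in> cells K; \<beta> \<in> cells K; inc K \<alpha> \<sigma> \<noteq> 0; inc K \<tau> \<beta> \<noteq> 0\<rbrakk> \<Longrightarrow> f \<beta> \<le> f \<alpha>"
  shows "keeps_reversals K f (reduce_pair K \<tau> \<sigma>) f"
proof -
  let ?L = "reduce_pair K \<tau> \<sigma>"
  have "reversed ?L f \<alpha> \<beta> \<longleftrightarrow> reversed K f \<alpha> \<beta>" if "\<alpha> \<in> cells ?L" "\<beta> \<in> cells ?L" for \<alpha> \<beta>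
  proof (cases "inc K \<alpha> \<sigma> = 0 \<or> inc K \<tau> \<beta> = 0")
    case True
    then show ?thesis
      by (auto simp: reversed_def)
  next
    case False
    then have "f \<beta> \<le> f \<alpha>"
      using assms(4) that by auto
    then show ?thesis
      by (simp add: reversed_def)
  qed
  moreover have "\<not> reversed K f \<alpha> \<beta>" "\<not> reversed K f \<beta> \<alpha>"
    if "\<alpha> = \<tau> \<or> \<alpha> = \<sigma>" "\<beta> \<in> cells ?L" for \<alpha> \<beta>
    using that assms(1,2) unfolding weakly_critical_iff by auto
  ultimately show ?thesis
    unfolding keeps_reversals_def by auto
qed

lemma keeps_reversals_reduce_level:
  assumes "weakly_critical K f \<tau>" "weakly_critical K f \<sigma>" "inc K \<tau> \<sigma> \<noteq> 0" "f \<tau> = f \<sigma>"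
  shows "keeps_reversals K f (reduce_pair K \<tau> \<sigma>) f"
proof (rule keeps_reversals_reduce_critical)
  fix \<alpha> \<beta>
  assume "\<alpha> \<in> cells K" "\<beta> \<in> cells K" "inc K \<alpha> \<sigma> \<noteq> 0" "inc K \<tau> \<beta> \<noteq> 0"
  then have "f \<sigma> \<le> f \<alpha>" "f \<beta> \<le> f \<tau>"
    using weakly_critical_le_up[OF assms(2)] weakly_critical_ge_down[OF assms(1)] by blast+
  then show "f \<beta> \<le> f \<alpha>"
    using assms(4) by simp
qed (use assms in auto)

text \<open>
  Both ranks drop together: forming \<open>W\<close> commutes with the reduction.  Indeed the correction term at
  a level pair \<open>(\<alpha>, \<beta>)\<close> is nonzero only if \<open>f \<beta> \<le> f \<tau> = f \<sigma> \<le> f \<alpha> = f \<beta>\<close>, and then the incidence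
  numbers entering it agree in \<open>K\<close> and \<open>W\<close>.
\<close>

lemma excess_reduce_level:
  assumes "weakly_critical K f \<tau>" "weakly_critical K f \<sigma>" "inc K \<tau> \<sigma> \<noteq> 0" "f \<tau> = f \<sigma>"
  shows "excess (reduce_pair K \<tau> \<sigma>) f k = excess K f k"
proof -
  let ?L = "reduce_pair K \<tau> \<sigma>"
  note keeps = keeps_reversals_reduce_level[OF assms]
  interpret P: incident_pair K \<tau> \<sigma>
    using assms weakly_critical_cell[of K f] by (intro incident_pairI) auto
  interpret L: morse_bott ?L f
    by (intro morse_bott.intro morse_bott_axioms.intro P.lefschetz_reduce_pair
        keeps_reversals_morse_bott[OF keeps] morse_bott)
  interpret W: lefschetz_complex W
    by (rule lefschetz_W)
  interpret PW: incident_pair W \<tau> \<sigma>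
    using assms by unfold_locales auto
  have "boundary_rank L.W (Suc k) = boundary_rank (reduce_pair W \<tau> \<sigma>) (Suc k)"
  proof (rule boundary_rank_remove_isolated[where A = "{}"])
    show "cells L.W = cells (reduce_pair W \<tau> \<sigma>) - {}"
      using keeps_reversals_weakly_critical[OF keeps] weakly_critical_cell[of K f] by auto
    show "inc L.W \<alpha> \<beta> = inc (reduce_pair W \<tau> \<sigma>) \<alpha> \<beta>"
      if "\<alpha> \<in> cells L.W" "\<beta> \<in> cells L.W" for \<alpha> \<beta>
    proof -
      have "f \<alpha> = f \<sigma> \<and> f \<tau> = f \<beta>" if "f \<alpha> = f \<beta>" "inc K \<alpha> \<sigma> \<noteq> 0" "inc K \<tau> \<beta> \<noteq> 0"
      proof -
        have "\<alpha> \<in> cells K" "\<beta> \<in> cells K"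
          using \<open>\<alpha> \<in> cells L.W\<close> \<open>\<beta> \<in> cells L.W\<close> weakly_critical_cell[of ?L f] by auto
        then have "f \<sigma> \<le> f \<alpha>" "f \<beta> \<le> f \<tau>"
          using that weakly_critical_le_up[OF assms(2)] weakly_critical_ge_down[OF assms(1)] by blast+
        then show ?thesis
          using that assms(4) by simp
      qed
      then have "inc K \<alpha> \<sigma> * inc K \<tau> \<beta> = inc W \<alpha> \<sigma> * inc W \<tau> \<beta>" if "f \<alpha> = f \<beta>"
        using that by (cases "inc K \<alpha> \<sigma> = 0 \<or> inc K \<tau> \<beta> = 0") auto
      moreover have "inc W \<alpha> \<sigma> * inc W \<tau> \<beta> = 0" if "f \<alpha> \<noteq> f \<beta>"
        using that assms(4) by auto
      moreover have "inc W \<tau> \<sigma> = inc K \<tau> \<sigma>"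
        using assms(4) by simp
      ultimately show ?thesis
        unfolding reduce_pair_simps(3)
        by (cases "f \<alpha> = f \<beta>") (simp_all del: weakly_critical_complex_simps(3) add: weakly_critical_complex_simps(3)[of _ _ \<alpha> \<beta>])
    qed
  qed (use L.lefschetz_W PW.lefschetz_reduce_pair in auto)
  moreover have "d_snc ?L f (Suc k) = d_snc K f (Suc k)"
    using assms(1,2)
    by (intro keeps_reversals_d_snc_eq[OF keeps finite_kcells]) (auto simp: weakly_critical_def)
  ultimately show ?thesis
    using P.boundary_rank_reduce_pair[of "Suc k"] PW.boundary_rank_reduce_pair[of "Suc k"]
    by (simp add: excess_eq L.excess_eq)
qed

lemma keeps_reversals_reduce_dimension:
  assumes "weakly_critical K f \<mu>" "weakly_critical K f \<kappa>" "inc K \<mu> \<kappa> \<noteq> 0"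
    and "\<And>\<sigma>. \<lbrakk>\<sigma> \<in> cells K; cdim K \<sigma> \<in> {cdim K \<mu>, cdim K \<kappa>}\<rbrakk> \<Longrightarrow> f \<sigma> = real (cdim K \<sigma>)"
  shows "keeps_reversals K f (reduce_pair K \<mu> \<kappa>) f"
proof (rule keeps_reversals_reduce_critical)
  fix \<alpha> \<beta>
  assume "\<alpha> \<in> cells K" "\<beta> \<in> cells K" "inc K \<alpha> \<kappa> \<noteq> 0" "inc K \<mu> \<beta> \<noteq> 0"
  moreover have "\<mu> \<in> cells K" "\<kappa> \<in> cells K"
    using assms(1,2) weakly_critical_cell[of K f] by blast+
  ultimately have "cdim K \<alpha> = cdim K \<mu>" "cdim K \<beta> = cdim K \<kappa>" "cdim K \<mu> = Suc (cdim K \<kappa>)"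
    using inc_nonzero_dim assms(3) by (metis nat.inject)+
  then show "f \<beta> \<le> f \<alpha>"
    using assms(4)[of \<alpha>] assms(4)[of \<beta>] \<open>\<alpha> \<in> cells K\<close> \<open>\<beta> \<in> cells K\<close> by simp
qed (use assms in auto)

text \<open>
  Being isolated in \<open>W\<close>, the two cells contribute nothing to its ranks, and the changed incidence
  numbers belong to pairs at different levels.  Hence the rank for \<open>K\<close> drops alone.
\<close>

lemma excess_reduce_dimension:
  assumes "weakly_critical K f \<mu>" "weakly_critical K f \<kappa>" "inc K \<mu> \<kappa> \<noteq> 0"
    and dim: "\<And>\<sigma>. \<lbrakk>\<sigma> \<in> cells K; cdim K \<sigma> \<in> {cdim K \<mu>, cdim K \<kappa>}\<rbrakk> \<Longrightarrow> f \<sigma> = real (cdim K \<sigma>)"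
    and iso: "isolated W \<mu>" "isolated W \<kappa>"
  shows "excess K f k = excess (reduce_pair K \<mu> \<kappa>) f k + (if k = cdim K \<kappa> then 1 else 0)"
proof -
  let ?L = "reduce_pair K \<mu> \<kappa>"
  note keeps = keeps_reversals_reduce_dimension[OF assms(1-4)]
  interpret P: incident_pair K \<mu> \<kappa>
    using assms weakly_critical_cell[of K f] by (intro incident_pairI) auto
  interpret L: morse_bott ?L f
    by (intro morse_bott.intro morse_bott_axioms.intro P.lefschetz_reduce_pair
        keeps_reversals_morse_bott[OF keeps] morse_bott)
  have "boundary_rank L.W (Suc k) = boundary_rank W (Suc k)"
  proof (rule boundary_rank_remove_isolated[where A = "{\<mu>, \<kappa>}"])
    show "cells L.W = cells W - {\<mu>, \<kappa>}"
      using keeps_reversals_weakly_critical[OF keeps] weakly_critical_cell[of K f] by auto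
    show "inc L.W \<alpha> \<beta> = inc W \<alpha> \<beta>" if "\<alpha> \<in> cells L.W" "\<beta> \<in> cells L.W" for \<alpha> \<beta>
    proof -
      have cells: "\<alpha> \<in> cells K" "\<beta> \<in> cells K"
        using that weakly_critical_cell[of ?L f] by auto
      have "f \<alpha> \<noteq> f \<beta>" if "inc K \<alpha> \<kappa> \<noteq> 0" "inc K \<mu> \<beta> \<noteq> 0"
      proof -
        have "cdim K \<alpha> = cdim K \<mu>" "cdim K \<beta> = cdim K \<kappa>"
          using that cells P.mu P.kappa P.dim_mu inc_nonzero_dim by (metis nat.inject)+
        then show ?thesis
          using dim[of \<alpha>] dim[of \<beta>] cells P.dim_mu by simp
      qed
      then show ?thesis
        by auto
    qed
  qed (use L.lefschetz_W lefschetz_W iso in auto)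
  moreover have "d_snc ?L f (Suc k) = d_snc K f (Suc k)"
    using assms(1,2)
    by (intro keeps_reversals_d_snc_eq[OF keeps finite_kcells]) (auto simp: weakly_critical_def)
  ultimately show ?thesis
    using P.boundary_rank_reduce_pair[of "Suc k"] P.dim_mu by (simp add: excess_eq L.excess_eq)
qed

lemma excess_relevel:
  assumes keeps: "keeps_reversals K f K g"
    and eq: "\<And>\<tau> \<sigma>. \<lbrakk>\<tau> \<in> cells K; \<sigma> \<in> cells K; inc K \<tau> \<sigma> \<noteq> 0\<rbrakk> \<Longrightarrow> g \<tau> = g \<sigma> \<longleftrightarrow> f \<tau> = f \<sigma>"
  shows "excess K g k = excess K f k"
proof -
  interpret g: morse_bott K g
    by unfold_locales (rule keeps_reversals_morse_bott[OF keeps morse_bott])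
  have "boundary_rank g.W (Suc k) = boundary_rank W (Suc k)"
  proof (rule boundary_rank_remove_isolated[where A = "{}"])
    show "cells g.W = cells W - {}"
      using keeps_reversals_weakly_critical[OF keeps] weakly_critical_cell[of K f] by auto
    show "inc g.W \<alpha> \<beta> = inc W \<alpha> \<beta>" if "\<alpha> \<in> cells g.W" "\<beta> \<in> cells g.W" for \<alpha> \<beta>
      using that eq[of \<alpha> \<beta>] weakly_critical_cell[of K g] by auto
  qed (use g.lefschetz_W lefschetz_W in auto)
  moreover have "d_snc K g (Suc k) = d_snc K f (Suc k)"
    by (intro keeps_reversals_d_snc_eq[OF keeps finite_kcells]) auto
  ultimately show ?thesis
    by (simp add: excess_eq g.excess_eq)
qed

end

lemma remove_cell_simps [simp]:
  "cells (remove_cell K \<eta>) = cells K - {\<eta>}"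
  "cdim (remove_cell K \<eta>) = cdim K"
  "inc (remove_cell K \<eta>) = inc K"
  by (simp_all add: remove_cell_def)

lemma kcells_remove_cell: "kcells (remove_cell K \<eta>) k = kcells K k - {\<eta>}"
  by (auto simp: kcells_def)

context lefschetz_complex
begin

lemma lefschetz_remove_isolated:
  assumes "isolated K \<eta>"
  shows "lefschetz_complex (remove_cell K \<eta>)"
proof
  let ?L = "remove_cell K \<eta>"
  show "finite (kcells ?L k)" for k
    using finite_kcells by (simp add: kcells_remove_cell)
  show "int (cdim ?L \<tau>) - int (cdim ?L \<sigma>) = 1"
    if "\<tau> \<in> cells ?L" "\<sigma> \<in> cells ?L" "inc ?L \<tau> \<sigma> \<noteq> 0" for \<tau> \<sigma>
    using that inc_dim by simp
  show "(\<Sum>\<sigma> | \<sigma> \<in> cells ?L \<and> inc ?L \<tau> \<sigma> * inc ?L \<sigma> \<nu> \<noteq> 0. inc ?L \<tau> \<sigma> * inc ?L \<sigma> \<nu>) = 0"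
    if "\<tau> \<in> cells ?L" "\<nu> \<in> cells ?L" for \<tau> \<nu>
  proof -
    have "{\<sigma> \<in> cells ?L. inc ?L \<tau> \<sigma> * inc ?L \<sigma> \<nu> \<noteq> 0} = {\<sigma> \<in> cells K. inc K \<tau> \<sigma> * inc K \<sigma> \<nu> \<noteq> 0}"
      using assms that by (auto simp: isolated_def)
    then show ?thesis
      using inc_inc that by simp
  qed
qed

lemma betti_remove_isolated:
  assumes "isolated K \<eta>" "\<eta> \<in> cells K"
  shows "betti K k = betti (remove_cell K \<eta>) k + (if k = cdim K \<eta> then 1 else 0)"
proof -
  let ?L = "remove_cell K \<eta>"
  interpret L: lefschetz_complex ?L
    by (rule lefschetz_remove_isolated[OF assms(1)])
  have rank: "boundary_rank ?L i = boundary_rank K i" for i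
    using assms(1) lefschetz_complex_axioms L.lefschetz_complex_axioms
    by (intro boundary_rank_remove_isolated[where A = "{\<eta>}"]) auto
  have "card (kcells K k) = card (kcells ?L k) + card (kcells K k \<inter> {\<eta>})"
    unfolding kcells_remove_cell using card_Int_Diff[OF finite_kcells[of k], of "{\<eta>}"] by simp
  moreover have "kcells K k \<inter> {\<eta>} = (if k = cdim K \<eta> then {\<eta>} else {})"
    using assms(2) by (auto simp: mem_kcells)
  ultimately show ?thesis
    using betti_eq[of k] L.betti_eq[of k] rank by (auto split: if_splits)
qed

end

context morse_bott
begin

lemma keeps_reversals_remove_isolated:
  "isolated K \<eta> \<Longrightarrow> keeps_reversals K f (remove_cell K \<eta>) f"
  by (auto simp: keeps_reversals_def isolated_def reversed_def)

lemma excess_remove_isolated: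
  assumes "isolated K \<eta>" "\<eta> \<in> cells K"
  shows "excess (remove_cell K \<eta>) f k = excess K f k"
proof -
  let ?L = "remove_cell K \<eta>"
  note keeps = keeps_reversals_remove_isolated[OF assms(1)]
  interpret L: morse_bott ?L f
    by (intro morse_bott.intro morse_bott_axioms.intro lefschetz_remove_isolated[OF assms(1)]
        keeps_reversals_morse_bott[OF keeps] morse_bott)
  have "boundary_rank ?L (Suc k) = boundary_rank K (Suc k)"
    using assms(1) lefschetz_complex_axioms L.lefschetz_complex_axioms
    by (intro boundary_rank_remove_isolated[where A = "{\<eta>}"]) auto
  moreover have "boundary_rank L.W (Suc k) = boundary_rank W (Suc k)"
  proof (rule boundary_rank_remove_isolated[where A = "{\<eta>}"])
    show "cells L.W = cells W - {\<eta>}"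
      using keeps_reversals_weakly_critical[OF keeps] weakly_critical_cell[of K f] by auto
  qed (use L.lefschetz_W lefschetz_W assms(1) weakly_critical_cell[of K f] in \<open>auto simp: isolated_def\<close>)
  moreover have "d_snc ?L f (Suc k) = d_snc K f (Suc k)"
    using assms D_snc_eq_0[OF assms(2)]
    by (intro keeps_reversals_d_snc_eq[OF keeps finite_kcells]) (auto simp: isolated_def reversed_def)
  ultimately show ?thesis
    by (simp add: excess_eq L.excess_eq)
qed

end

section \<open>Loops and the two conserved quantities\<close>

lemma as_long_as_possible_invariant:
  assumes "as_long_as_possible r S T" "I S" "\<And>S T. \<lbrakk>I S; r S T\<rbrakk> \<Longrightarrow> I T"
  shows "I T"
proof -
  have "r\<^sup>*\<^sup>* S T"
    using assms(1) by (simp add: as_long_as_possible_def)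
  then show ?thesis
    by induction (use assms(2,3) in blast)+
qed

lemma as_long_as_possible_exists:
  fixes m :: "'s \<Rightarrow> nat"
  assumes "I S" "\<And>S T. \<lbrakk>I S; r S T\<rbrakk> \<Longrightarrow> I T \<and> m T < m S"
  shows "\<exists>T. as_long_as_possible r S T"
  using assms(1)
proof (induction "m S" arbitrary: S rule: less_induct)
  case less
  show ?case
  proof (cases "\<exists>T. r S T")
    case True
    then obtain T where T: "r S T" "I T" "m T < m S"
      using assms(2) less.prems by blast
    then obtain U where "as_long_as_possible r T U"
      using less.hyps by blast
    then show ?thesis
      using T(1) unfolding as_long_as_possible_def by (meson converse_rtranclp_into_rtranclp)
  next
    case False
    then show ?thesis
      unfolding as_long_as_possible_def by blast
  qed
qed

text \<open>
  The last two conjuncts are the conservation laws.  Disjointness of the records from the current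
  cells guarantees that each new record increases its count.
\<close>

definition reduction_invariant ::
    "'a lefschetz \<Rightarrow> ('a \<Rightarrow> real) \<Rightarrow> nat \<Rightarrow> 'a reduction_state \<Rightarrow> bool" where
  "reduction_invariant K f n S \<longleftrightarrow>
     morse_bott (current S) (func S) \<and> cdim (current S) = cdim K \<and>
     (\<forall>\<sigma>\<in>cells (current S). n \<le> cdim K \<sigma>) \<and>
     finite (blocks S) \<and> finite (removed S) \<and>
     fst ` blocks S \<inter> cells (current S) = {} \<and> removed S \<inter> cells (current S) = {} \<and>
     (\<forall>k. excess (current S) (func S) k + int (card {p \<in> blocks S. cdim K (fst p) = Suc k})
          = excess K f k) \<and>
     (\<forall>k. betti (current S) k + card {\<eta> \<in> removed S. cdim K \<eta> = k} = betti K k)"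

lemma reduction_invariant_keeps:
  assumes "reduction_invariant K f n S"
    and keeps: "keeps_reversals (current S) (func S) (current T) (func T)"
    and "lefschetz_complex (current T)"
    and "blocks T = blocks S" "removed T = removed S"
    and "\<And>k. excess (current T) (func T) k = excess (current S) (func S) k"
    and "\<And>k. betti (current T) k = betti (current S) k"
  shows "reduction_invariant K f n T"
proof -
  interpret S: morse_bott "current S" "func S"
    using assms(1) by (simp add: reduction_invariant_def)
  have "morse_bott (current T) (func T)"
    by (intro morse_bott.intro morse_bott_axioms.intro assms(3)
        keeps_reversals_morse_bott[OF keeps] S.morse_bott)
  moreover have "cells (current T) \<subseteq> cells (current S)" "cdim (current T) = cdim (current S)"
    using keeps by (auto simp: keeps_reversals_def)
  ultimately show ?thesis
    using assms(1,4-7) unfolding reduction_invariant_def by auto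
qed

text \<open>
  If a reversed pair starts in a cell of dimension less than \<open>m\<close>, it also ends in one; controlling \<open>U\<close>
  thus makes all these cells weakly critical.
\<close>

definition no_reversals_below :: "nat \<Rightarrow> 'a reduction_state \<Rightarrow> bool" where
  "no_reversals_below m S \<longleftrightarrow>
     (\<forall>\<sigma>\<in>cells (current S). cdim (current S) \<sigma> < m \<longrightarrow> up_cells (current S) (func S) \<sigma> = {})"

lemma no_reversals_below_keeps:
  assumes "no_reversals_below m S" "keeps_reversals (current S) (func S) (current T) (func T)"
  shows "no_reversals_below m T"
  using assms keeps_reversals_cells[OF assms(2)] keeps_reversals_subset[OF assms(2)]
  unfolding no_reversals_below_def by (simp add: keeps_reversals_def)

lemma no_reversals_below_weakly_critical:
  assumes "lefschetz_complex (current S)" "no_reversals_below m S"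
    and "\<sigma> \<in> cells (current S)" "cdim (current S) \<sigma> < m"
  shows "weakly_critical (current S) (func S) \<sigma>"
proof -
  interpret S: lefschetz_complex "current S"
    by fact
  have none: "\<not> reversed (current S) (func S) \<tau> \<rho>"
    if "\<tau> \<in> cells (current S)" "\<rho> \<in> cells (current S)" "cdim (current S) \<rho> < m" for \<tau> \<rho>
    using that assms(2) unfolding no_reversals_below_def up_cells_reversed by blast
  have "\<not> reversed (current S) (func S) \<sigma> \<nu>" if "\<nu> \<in> cells (current S)" for \<nu>
  proof
    assume rev: "reversed (current S) (func S) \<sigma> \<nu>"
    then have "cdim (current S) \<nu> < m"
      using S.inc_nonzero_dim[of \<sigma> \<nu>] assms(3,4) that by (simp add: reversed_def)
    then show False
      using none[of \<sigma> \<nu>] rev assms(3) that by simp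
  qed
  then show ?thesis
    unfolding S.weakly_critical_iff using none assms(3,4) by blast
qed

lemma card_kcells_reduce_pair:
  assumes "lefschetz_complex K" "\<rho> \<in> kcells K k" "\<rho> \<in> {\<mu>, \<kappa>}"
  shows "card (kcells (reduce_pair K \<mu> \<kappa>) k) < card (kcells K k)"
  using assms lefschetz_complex.finite_kcells[OF assms(1), of k]
  by (intro psubset_card_mono) (auto simp: kcells_reduce_pair)

section \<open>The steps of a stage\<close>

lemma move_Ia_step:
  assumes inv: "reduction_invariant K f n S" and none: "no_reversals_below j S" and "move_Ia j S T"
  shows "reduction_invariant K f n T" "no_reversals_below j T"
    and "card (kcells (current T) j) < card (kcells (current S) j)"
proof -
  interpret S: morse_bott "current S" "func S"
    using inv by (simp add: reduction_invariant_def)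
  obtain \<sigma> \<tau> where \<sigma>: "\<sigma> \<in> kcells (current S) j" and \<tau>: "\<tau> \<in> up_cells (current S) (func S) \<sigma>"
    and T: "T = S\<lparr>current := reduce_pair (current S) \<tau> \<sigma>\<rparr>"
    using assms(3) unfolding move_Ia_def by blast
  have pair: "\<tau> \<in> cells (current S)" "\<sigma> \<in> cells (current S)" "reversed (current S) (func S) \<tau> \<sigma>"
    using \<sigma> \<tau> by (auto simp: mem_kcells up_cells_reversed)
  interpret P: incident_pair "current S" \<tau> \<sigma>
    using pair by (intro S.incident_pairI) (auto simp: reversed_def)
  have keeps: "keeps_reversals (current S) (func S) (current T) (func T)"
    using S.keeps_reversals_reduce_reversed(1)[OF pair] T by simp
  show "reduction_invariant K f n T"
    by (rule reduction_invariant_keeps[OF inv keeps])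
      (simp_all add: T P.lefschetz_reduce_pair P.betti_reduce_pair S.excess_reduce_reversed[OF pair])
  show "no_reversals_below j T"
    by (rule no_reversals_below_keeps[OF none keeps])
  show "card (kcells (current T) j) < card (kcells (current S) j)"
    using card_kcells_reduce_pair[OF S.lefschetz_complex_axioms \<sigma>, of \<tau> \<sigma>] T by simp
qed

lemma phase_Ia:
  assumes "reduction_invariant K f n S" "no_reversals_below j S"
    and "as_long_as_possible (move_Ia j) S T"
  shows "reduction_invariant K f n T" "no_reversals_below (Suc j) T"
proof -
  have "reduction_invariant K f n T \<and> no_reversals_below j T"
    using assms(3)
    by (rule as_long_as_possible_invariant) (use assms(1,2) in \<open>auto intro: move_Ia_step\<close>)
  then have inv: "reduction_invariant K f n T" and none: "no_reversals_below j T"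
    by blast+
  then show "reduction_invariant K f n T"
    by blast
  interpret T: morse_bott "current T" "func T"
    using inv by (simp add: reduction_invariant_def)
  have "up_cells (current T) (func T) \<sigma> = {}" if "\<sigma> \<in> kcells (current T) j" for \<sigma>
  proof (rule ccontr)
    assume "up_cells (current T) (func T) \<sigma> \<noteq> {}"
    moreover then have "U_snc (current T) (func T) \<sigma> \<noteq> 0"
      using T.finite_up_cells[of \<sigma> "func T"] that by (simp add: U_snc_def mem_kcells)
    then have "U_snc (current T) (func T) \<sigma> = 1"
      using T.morse_bott that by (auto simp: discrete_morse_bott_def mem_kcells le_Suc_eq)
    ultimately have "\<exists>U. move_Ia j T U"
      using that unfolding move_Ia_def by blast
    then show False
      using assms(3) unfolding as_long_as_possible_def by blast
  qed
  then show "no_reversals_below (Suc j) T"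
    using none unfolding no_reversals_below_def by (auto simp: mem_kcells less_Suc_eq)
qed

lemma phase_Ia_exists:
  assumes "reduction_invariant K f n S" "no_reversals_below j S"
  shows "\<exists>T. as_long_as_possible (move_Ia j) S T"
  by (rule as_long_as_possible_exists[where m = "\<lambda>S. card (kcells (current S) j)"
        and I = "\<lambda>S. reduction_invariant K f n S \<and> no_reversals_below j S"])
    (use assms in \<open>auto intro: move_Ia_step\<close>)

lemma move_Ib_step:
  assumes inv: "reduction_invariant K f n S" and none: "no_reversals_below (n + 3) S"
    and "move_Ib n S T"
  shows "reduction_invariant K f n T" "no_reversals_below (n + 3) T"
    and "card (kcells (current T) (n + 1)) < card (kcells (current S) (n + 1))"
proof -
  interpret S: morse_bott "current S" "func S"
    using inv by (simp add: reduction_invariant_def)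
  obtain \<tau> \<sigma> where pair: "\<tau> \<in> cells (current S)" "\<sigma> \<in> cells (current S)" "inc (current S) \<tau> \<sigma> \<noteq> 0"
    and level: "func S \<tau> = func S \<sigma>"
    and dims: "(cdim (current S) \<tau>, cdim (current S) \<sigma>) \<in> {(n + 2, n + 1), (n + 1, n)}"
    and T: "T = S\<lparr>current := reduce_pair (current S) \<tau> \<sigma>\<rparr>"
    using assms(3) unfolding move_Ib_def by blast
  have wc: "weakly_critical (current S) (func S) \<tau>" "weakly_critical (current S) (func S) \<sigma>"
    using no_reversals_below_weakly_critical[OF S.lefschetz_complex_axioms none] pair dims by auto
  interpret P: incident_pair "current S" \<tau> \<sigma>
    using pair by (intro S.incident_pairI)
  have keeps: "keeps_reversals (current S) (func S) (current T) (func T)"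
    using S.keeps_reversals_reduce_level[OF wc pair(3) level] T by simp
  show "reduction_invariant K f n T"
    by (rule reduction_invariant_keeps[OF inv keeps])
      (simp_all add: T P.lefschetz_reduce_pair P.betti_reduce_pair
        S.excess_reduce_level[OF wc pair(3) level])
  show "no_reversals_below (n + 3) T"
    by (rule no_reversals_below_keeps[OF none keeps])
  have "\<tau> \<in> kcells (current S) (n + 1) \<or> \<sigma> \<in> kcells (current S) (n + 1)"
    using pair dims by (auto simp: mem_kcells)
  then show "card (kcells (current T) (n + 1)) < card (kcells (current S) (n + 1))"
    using card_kcells_reduce_pair[OF S.lefschetz_complex_axioms, of _ "n + 1" \<tau> \<sigma>] T by auto
qed

lemma phase_Ib:
  assumes "reduction_invariant K f n S" "no_reversals_below (n + 3) S"
    and "as_long_as_possible (move_Ib n) S T"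
  shows "reduction_invariant K f n T \<and> no_reversals_below (n + 3) T"
  using assms(3)
  by (rule as_long_as_possible_invariant) (use assms(1,2) in \<open>auto intro: move_Ib_step\<close>)

lemma phase_Ib_exists:
  assumes "reduction_invariant K f n S" "no_reversals_below (n + 3) S"
  shows "\<exists>T. as_long_as_possible (move_Ib n) S T"
  by (rule as_long_as_possible_exists[where m = "\<lambda>S. card (kcells (current S) (n + 1))"
        and I = "\<lambda>S. reduction_invariant K f n S \<and> no_reversals_below (n + 3) S"])
    (use assms in \<open>auto intro: move_Ib_step(1,2) move_Ib_step(3)[simplified]\<close>)

text \<open>
  What the fourth move relies on: up to dimension \<open>n + 2\<close> the function increases strictly along
  incidences, and it is the dimension on the \<open>n\<close>-cells and the \<open>(n + 1)\<close>-cells.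
\<close>

definition levelled :: "nat \<Rightarrow> 'a reduction_state \<Rightarrow> bool" where
  "levelled n S \<longleftrightarrow> (\<forall>\<sigma>\<in>cells (current S).
     (cdim (current S) \<sigma> \<le> n + 1 \<longrightarrow> func S \<sigma> = real (cdim (current S) \<sigma>)) \<and>
     (cdim (current S) \<sigma> = n + 2 \<longrightarrow> real (n + 2) \<le> func S \<sigma>))"

lemma levelled_increasing:
  assumes "lefschetz_complex (current S)" "levelled n S"
    and "\<tau> \<in> cells (current S)" "\<sigma> \<in> cells (current S)" "inc (current S) \<tau> \<sigma> \<noteq> 0"
    and "cdim (current S) \<tau> \<le> n + 2"
  shows "func S \<sigma> < func S \<tau>"
proof -
  have d: "cdim (current S) \<tau> = Suc (cdim (current S) \<sigma>)"
    by (rule lefschetz_complex.inc_nonzero_dim[OF assms(1,3-5)])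
  have \<sigma>: "func S \<sigma> = real (cdim (current S) \<sigma>)"
    using assms(2,4,6) d by (simp add: levelled_def)
  have \<tau>: "real (cdim (current S) \<tau>) \<le> func S \<tau>"
  proof (cases "cdim (current S) \<tau> = n + 2")
    case True
    then show ?thesis
      using assms(2,3) unfolding levelled_def by metis
  next
    case False
    then show ?thesis
      using assms(2,3,6) by (simp add: levelled_def)
  qed
  show ?thesis
    using \<sigma> \<tau> d by simp
qed

text \<open>
  With neither reversed nor level pairs left up to dimension \<open>n + 2\<close>, the old function increases
  strictly along the incidences there, and so does the new one.  Above, both cells of an incident
  pair are shifted by the same amount.  Hence the two functions have the same reversed and the same
  level pairs.
\<close>

lemma phase_III:
  assumes inv: "reduction_invariant K f n S" and none: "no_reversals_below (n + 3) S"
    and no_level: "\<nexists>T. move_Ib n S T" and "move_III n S T"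
  shows "reduction_invariant K f n T" "levelled n T"
proof -
  interpret S: morse_bott "current S" "func S"
    using inv by (simp add: reduction_invariant_def)
  let ?M = "current S" and ?g = "func S" and ?h = "func T"
  define c where "c = shift n ?M ?g"
  have M: "current T = ?M" "blocks T = blocks S" "removed T = removed S"
    and h: "\<And>\<sigma>. ?h \<sigma> = (if cdim ?M \<sigma> \<le> n + 1 then real (cdim ?M \<sigma>) else ?g \<sigma> + c)"
    using assms(4) by (auto simp: move_III_def c_def)
  have ge: "n \<le> cdim ?M \<sigma>" if "\<sigma> \<in> cells ?M" for \<sigma>
    using inv that by (simp add: reduction_invariant_def)
  have "real (n + 2) \<le> ?h \<sigma>" if "\<sigma> \<in> kcells ?M (n + 2)" for \<sigma>
  proof -
    have "Min (?g ` kcells ?M (n + 2)) \<le> ?g \<sigma>"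
      using S.finite_kcells that by (intro Min_le) auto
    then show ?thesis
      using that by (auto simp: h c_def shift_def mem_kcells)
  qed
  then show lev: "levelled n T"
    unfolding levelled_def M by (simp add: h mem_kcells)
  have low: "?h \<sigma> < ?h \<tau>" "?g \<sigma> < ?g \<tau>"
    if "\<tau> \<in> cells ?M" "\<sigma> \<in> cells ?M" "inc ?M \<tau> \<sigma> \<noteq> 0" "cdim ?M \<tau> \<le> n + 2" for \<tau> \<sigma>
  proof -
    show "?h \<sigma> < ?h \<tau>"
      using levelled_increasing[of T n \<tau> \<sigma>] S.lefschetz_complex_axioms lev that M by simp
    have d: "cdim ?M \<tau> = Suc (cdim ?M \<sigma>)"
      using S.inc_nonzero_dim that by blast
    have "weakly_critical ?M ?g \<sigma>"
      using no_reversals_below_weakly_critical[OF S.lefschetz_complex_axioms none] that d by simp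
    then have "?g \<sigma> \<le> ?g \<tau>"
      using S.weakly_critical_le_up that by blast
    moreover have "?g \<tau> \<noteq> ?g \<sigma>"
    proof
      assume "?g \<tau> = ?g \<sigma>"
      moreover have "(cdim ?M \<tau>, cdim ?M \<sigma>) \<in> {(n + 2, n + 1), (n + 1, n)}"
        using d ge[of \<sigma>] that by auto
      ultimately show False
        using no_level that unfolding move_Ib_def by blast
    qed
    ultimately show "?g \<sigma> < ?g \<tau>"
      by simp
  qed
  have high: "?h \<tau> = ?g \<tau> + c" "?h \<sigma> = ?g \<sigma> + c"
    if "\<tau> \<in> cells ?M" "\<sigma> \<in> cells ?M" "inc ?M \<tau> \<sigma> \<noteq> 0" "\<not> cdim ?M \<tau> \<le> n + 2" for \<tau> \<sigma>
    using S.inc_nonzero_dim[OF that(1-3)] that(4) by (simp_all add: h)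
  have same: "?h \<tau> < ?h \<sigma> \<longleftrightarrow> ?g \<tau> < ?g \<sigma>" "?h \<tau> = ?h \<sigma> \<longleftrightarrow> ?g \<tau> = ?g \<sigma>"
    if "\<tau> \<in> cells ?M" "\<sigma> \<in> cells ?M" "inc ?M \<tau> \<sigma> \<noteq> 0" for \<tau> \<sigma>
    using low[OF that] high[OF that] by (cases "cdim ?M \<tau> \<le> n + 2"; simp)+
  then have keeps: "keeps_reversals ?M ?g ?M ?h"
    unfolding keeps_reversals_def reversed_def by auto
  show "reduction_invariant K f n T"
    by (rule reduction_invariant_keeps[OF inv])
      (simp_all add: M keeps S.lefschetz_complex_axioms S.excess_relevel[OF keeps same(2)])
qed

lemma move_IV_step:
  assumes inv: "reduction_invariant K f n S" and lev: "levelled n S" and "move_IV n S T"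
  shows "reduction_invariant K f n T" "levelled n T"
    and "card (kcells (current T) n) < card (kcells (current S) n)"
proof -
  interpret S: morse_bott "current S" "func S"
    using inv by (simp add: reduction_invariant_def)
  let ?M = "current S" and ?g = "func S"
  obtain \<kappa> \<mu> where \<kappa>: "\<kappa> \<in> kcells ?M n" and \<mu>: "\<mu> \<in> kcells ?M (n + 1)" and inc: "inc ?M \<mu> \<kappa> \<noteq> 0"
    and T': "T = S\<lparr>current := reduce_pair ?M \<mu> \<kappa>,
            aside := disjoint_sum (aside S) (elementary_block (cdim ?M) \<mu> \<kappa>),
            blocks := insert (\<mu>, \<kappa>) (blocks S)\<rparr>"
    using assms(3) unfolding move_IV_def by blast
  have T: "current T = reduce_pair ?M \<mu> \<kappa>" "func T = ?g" "blocks T = insert (\<mu>, \<kappa>) (blocks S)"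
      "removed T = removed S"
    by (simp_all add: T')
  have dim: "cdim ?M = cdim K"
    using inv by (simp add: reduction_invariant_def)
  note incr = levelled_increasing[OF S.lefschetz_complex_axioms lev]
  have not_level: "inc ?M \<tau> \<sigma> = 0 \<or> ?g \<sigma> < ?g \<tau>"
    if "\<tau> \<in> cells ?M" "\<sigma> \<in> cells ?M" "cdim ?M \<tau> \<le> n + 1 \<or> cdim ?M \<sigma> \<le> n + 1" for \<tau> \<sigma>
    using incr[OF that(1,2)] S.inc_nonzero_dim[OF that(1,2)] that(3)
    by (cases "inc ?M \<tau> \<sigma> = 0") auto
  have crit: "weakly_critical ?M ?g \<rho> \<and> isolated S.W \<rho>"
    if "\<rho> \<in> cells ?M" "cdim ?M \<rho> \<le> n + 1" for \<rho>
  proof -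
    have "weakly_critical ?M ?g \<rho>"
      unfolding S.weakly_critical_iff reversed_def
      using not_level[of \<rho>] not_level[of _ \<rho>] that by (meson less_asym)
    moreover have "isolated S.W \<rho>"
      unfolding isolated_def
      using not_level[of \<rho>] not_level[of _ \<rho>] that weakly_critical_cell[of ?M ?g] by fastforce
    ultimately show ?thesis
      by blast
  qed
  have \<mu>\<kappa>: "\<mu> \<in> cells ?M" "\<kappa> \<in> cells ?M" "cdim ?M \<mu> = n + 1" "cdim ?M \<kappa> = n"
    using \<mu> \<kappa> by (auto simp: mem_kcells)
  have wc: "weakly_critical ?M ?g \<mu>" "weakly_critical ?M ?g \<kappa>"
    and iso: "isolated S.W \<mu>" "isolated S.W \<kappa>"
    using crit[of \<mu>] crit[of \<kappa>] \<mu>\<kappa> by auto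
  have g: "?g \<sigma> = real (cdim ?M \<sigma>)"
    if "\<sigma> \<in> cells ?M" "cdim ?M \<sigma> \<in> {cdim ?M \<mu>, cdim ?M \<kappa>}" for \<sigma>
    using that lev \<mu>\<kappa> by (auto simp: levelled_def)
  interpret P: incident_pair ?M \<mu> \<kappa>
    using \<mu>\<kappa> inc by (intro S.incident_pairI)
  have keeps: "keeps_reversals ?M ?g (current T) (func T)"
    using S.keeps_reversals_reduce_dimension[OF wc inc g] T by simp
  have mb: "morse_bott (current T) (func T)"
    using P.lefschetz_reduce_pair keeps_reversals_morse_bott[OF keeps S.morse_bott] T
    by (intro morse_bott.intro morse_bott_axioms.intro) simp_all
  have exc: "excess ?M ?g k = excess (current T) (func T) k + (if k = n then 1 else 0)" for k
    using S.excess_reduce_dimension[OF wc inc g iso, of k] \<mu>\<kappa> T by simp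
  have card: "card {p \<in> blocks T. cdim K (fst p) = Suc k}
      = card {p \<in> blocks S. cdim K (fst p) = Suc k} + (if k = n then 1 else 0)" for k
  proof -
    have "(\<mu>, \<kappa>) \<notin> blocks S"
      using inv \<mu>\<kappa>(1) by (force simp: reduction_invariant_def)
    moreover have "{p \<in> blocks T. cdim K (fst p) = Suc k}
      = (if k = n then insert (\<mu>, \<kappa>) {p \<in> blocks S. cdim K (fst p) = Suc k}
         else {p \<in> blocks S. cdim K (fst p) = Suc k})"
      using \<mu>\<kappa>(3) dim by (auto simp: T)
    ultimately show ?thesis
      using inv by (simp add: reduction_invariant_def)
  qed
  show "reduction_invariant K f n T"
    unfolding reduction_invariant_def
  proof (intro conjI allI)
    fix k
    have "excess ?M ?g k + int (card {p \<in> blocks S. cdim K (fst p) = Suc k}) = excess K f k"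
      using inv unfolding reduction_invariant_def by blast
    then show "excess (current T) (func T) k + int (card {p \<in> blocks T. cdim K (fst p) = Suc k})
        = excess K f k"
      using exc[of k] card[of k] by (cases "k = n") simp_all
    show "betti (current T) k + card {\<eta> \<in> removed T. cdim K \<eta> = k} = betti K k"
      using inv P.betti_reduce_pair[of k] by (simp add: reduction_invariant_def T(1,4))
  qed (use inv mb dim in \<open>auto simp: reduction_invariant_def T(1,3,4)\<close>)
  show "levelled n T"
    using lev by (simp add: levelled_def T)
  show "card (kcells (current T) n) < card (kcells (current S) n)"
    using card_kcells_reduce_pair[OF S.lefschetz_complex_axioms \<kappa>, of \<mu> \<kappa>] T by simp
qed

lemma phase_IV:
  assumes "reduction_invariant K f n S" "levelled n S"
    and "as_long_as_possible (move_IV n) S T"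
  shows "reduction_invariant K f n T"
proof -
  have "reduction_invariant K f n T \<and> levelled n T"
    using assms(3)
    by (rule as_long_as_possible_invariant) (use assms(1,2) in \<open>auto intro: move_IV_step\<close>)
  then show ?thesis
    by blast
qed

lemma phase_IV_exists:
  assumes "reduction_invariant K f n S" "levelled n S"
  shows "\<exists>T. as_long_as_possible (move_IV n) S T"
  by (rule as_long_as_possible_exists[where m = "\<lambda>S. card (kcells (current S) n)"
        and I = "\<lambda>S. reduction_invariant K f n S \<and> levelled n S"])
    (use assms in \<open>auto intro: move_IV_step\<close>)

lemma move_II_step:
  assumes inv: "reduction_invariant K f n S" and "move_II n S T"
  shows "reduction_invariant K f n T"
    and "card (kcells (current T) n) < card (kcells (current S) n)"
proof -
  interpret S: morse_bott "current S" "func S"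
    using inv by (simp add: reduction_invariant_def)
  let ?M = "current S" and ?g = "func S"
  obtain \<eta> where \<eta>: "\<eta> \<in> kcells ?M n" and iso: "isolated ?M \<eta>"
    and T': "T = S\<lparr>current := remove_cell ?M \<eta>, removed := insert \<eta> (removed S)\<rparr>"
    using assms(2) unfolding move_II_def by blast
  have T: "current T = remove_cell ?M \<eta>" "func T = ?g" "blocks T = blocks S"
      "removed T = insert \<eta> (removed S)"
    by (simp_all add: T')
  have dim: "cdim ?M = cdim K"
    using inv by (simp add: reduction_invariant_def)
  have \<eta>': "\<eta> \<in> cells ?M" "cdim ?M \<eta> = n"
    using \<eta> by (auto simp: mem_kcells)
  have "morse_bott (current T) (func T)"
    using S.lefschetz_remove_isolated[OF iso] T
      keeps_reversals_morse_bott[OF S.keeps_reversals_remove_isolated[OF iso] S.morse_bott]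
    by (intro morse_bott.intro morse_bott_axioms.intro) simp_all
  moreover have "excess (current T) (func T) k = excess ?M ?g k" for k
    using S.excess_remove_isolated[OF iso \<eta>'(1)] T by simp
  moreover have "betti ?M k = betti (current T) k + (if k = n then 1 else 0)" for k
    using S.betti_remove_isolated[OF iso \<eta>'(1), of k] \<eta>' T by simp
  moreover have "card {\<rho> \<in> removed T. cdim K \<rho> = k}
      = card {\<rho> \<in> removed S. cdim K \<rho> = k} + (if k = n then 1 else 0)" for k
  proof -
    have "\<eta> \<notin> removed S"
      using inv \<eta>'(1) by (auto simp: reduction_invariant_def)
    moreover have "{\<rho> \<in> removed T. cdim K \<rho> = k}
      = (if k = n then insert \<eta> {\<rho> \<in> removed S. cdim K \<rho> = k} else {\<rho> \<in> removed S. cdim K \<rho> = k})"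
      using \<eta>'(2) dim by (auto simp: T)
    ultimately show ?thesis
      using inv by (simp add: reduction_invariant_def)
  qed
  ultimately show "reduction_invariant K f n T"
    using inv \<eta>' unfolding reduction_invariant_def by (auto simp: T(1,3,4) algebra_simps)
  show "card (kcells (current T) n) < card (kcells ?M n)"
    using S.finite_kcells[of n] \<eta> by (intro psubset_card_mono) (auto simp: T kcells_remove_cell)
qed

lemma phase_II:
  assumes "reduction_invariant K f n S" "remove_all n S T"
  shows "reduction_invariant K f (Suc n) T"
proof -
  have run: "(move_II n)\<^sup>*\<^sup>* S T" and empty: "kcells (current T) n = {}"
    using assms(2) by (auto simp: remove_all_def)
  from run have inv: "reduction_invariant K f n T"
    by induction (use assms(1) in \<open>auto intro: move_II_step(1)\<close>)
  then have "Suc n \<le> cdim K \<sigma>" if "\<sigma> \<in> cells (current T)" for \<sigma>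
    using empty that by (force simp: reduction_invariant_def kcells_def Suc_le_eq le_neq_implies_less)
  then show ?thesis
    using inv by (simp add: reduction_invariant_def)
qed

text \<open>
  An incidence of an \<open>n\<close>-cell with an \<open>(n + 1)\<close>-cell would permit a fourth move, and there are no cells
  of dimension below \<open>n\<close>; so every \<open>n\<close>-cell is isolated and remains so while others are removed.
\<close>

lemma phase_II_exists:
  assumes inv: "reduction_invariant K f n S" and no_pair: "\<nexists>T. move_IV n S T"
  shows "\<exists>T. remove_all n S T"
proof -
  let ?iso = "\<lambda>S. \<forall>\<eta>\<in>kcells (current S) n. isolated (current S) \<eta>"
  interpret S: morse_bott "current S" "func S"
    using inv by (simp add: reduction_invariant_def)
  have iso: "?iso S"
  proof
    fix \<eta>
    assume \<eta>: "\<eta> \<in> kcells (current S) n"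
    show "isolated (current S) \<eta>"
      unfolding isolated_def
    proof (intro ballI conjI)
      fix \<sigma>
      assume \<sigma>: "\<sigma> \<in> cells (current S)"
      show "inc (current S) \<sigma> \<eta> = 0"
      proof (rule ccontr)
        assume "inc (current S) \<sigma> \<eta> \<noteq> 0"
        moreover then have "\<sigma> \<in> kcells (current S) (n + 1)"
          using S.inc_nonzero_dim[of \<sigma> \<eta>] \<sigma> \<eta> by (simp add: mem_kcells)
        ultimately show False
          using no_pair \<eta> unfolding move_IV_def by blast
      qed
      show "inc (current S) \<eta> \<sigma> = 0"
        using S.inc_nonzero_dim[of \<eta> \<sigma>] \<sigma> \<eta> inv
        by (force simp: mem_kcells reduction_invariant_def)
    qed
  qed
  have step: "?iso T" if "?iso S" "move_II n S T" for S T :: "'a reduction_state"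
    using that unfolding move_II_def by (auto simp: kcells_remove_cell isolated_def)
  obtain T where T: "as_long_as_possible (move_II n) S T"
    using as_long_as_possible_exists[where m = "\<lambda>S. card (kcells (current S) n)"
        and I = "reduction_invariant K f n" and r = "move_II n", OF inv]
      move_II_step[of K f n] by metis
  have "?iso T"
    by (rule as_long_as_possible_invariant[where I = ?iso, OF T iso step])
  then have "kcells (current T) n = {}"
    using T unfolding as_long_as_possible_def move_II_def by blast
  then show ?thesis
    using T unfolding remove_all_def as_long_as_possible_def by blast
qed

section \<open>Runs of the construction and their counts\<close>

lemma no_reversals_below_start: "reduction_invariant K f n S \<Longrightarrow> no_reversals_below n S"
  by (force simp: reduction_invariant_def no_reversals_below_def)

lemma stage_step:
  assumes "reduction_invariant K f n S" "stage n S T"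
  shows "reduction_invariant K f (Suc n) T"
proof -
  obtain S1 S2 S3 S4 S5 S6 where
    st: "as_long_as_possible (move_Ia n) S S1" "as_long_as_possible (move_Ia (n + 1)) S1 S2"
      "as_long_as_possible (move_Ia (n + 2)) S2 S3" "as_long_as_possible (move_Ib n) S3 S4"
      "move_III n S4 S5" "as_long_as_possible (move_IV n) S5 S6" "remove_all n S6 T"
    using assms(2) unfolding stage_def by blast
  have "reduction_invariant K f n S1" "no_reversals_below (n + 1) S1"
    using phase_Ia[OF assms(1) no_reversals_below_start[OF assms(1)] st(1)] by simp_all
  then have "reduction_invariant K f n S2" "no_reversals_below (n + 2) S2"
    using phase_Ia[OF _ _ st(2)] by simp_all
  then have "reduction_invariant K f n S3" "no_reversals_below (n + 3) S3"
    using phase_Ia[OF _ _ st(3)] by (simp_all add: eval_nat_numeral)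
  then have "reduction_invariant K f n S4" "no_reversals_below (n + 3) S4"
    using phase_Ib[OF _ _ st(4)] by simp_all
  then have "reduction_invariant K f n S5" "levelled n S5"
    using phase_III[OF _ _ _ st(5)] st(4) unfolding as_long_as_possible_def by blast+
  then have "reduction_invariant K f n S6"
    using phase_IV[OF _ _ st(6)] by simp
  then show ?thesis
    using phase_II[OF _ st(7)] by simp
qed

lemma stage_exists:
  assumes "reduction_invariant K f n S"
  shows "\<exists>T. stage n S T"
proof -
  obtain S1 where S1: "as_long_as_possible (move_Ia n) S S1"
    using phase_Ia_exists[OF assms no_reversals_below_start[OF assms]] by blast
  have 1: "reduction_invariant K f n S1" "no_reversals_below (n + 1) S1"
    using phase_Ia[OF assms no_reversals_below_start[OF assms] S1] by simp_all
  then obtain S2 where S2: "as_long_as_possible (move_Ia (n + 1)) S1 S2"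
    using phase_Ia_exists by blast
  have 2: "reduction_invariant K f n S2" "no_reversals_below (n + 2) S2"
    using phase_Ia[OF 1 S2] by simp_all
  then obtain S3 where S3: "as_long_as_possible (move_Ia (n + 2)) S2 S3"
    using phase_Ia_exists by blast
  have 3: "reduction_invariant K f n S3" "no_reversals_below (n + 3) S3"
    using phase_Ia[OF 2 S3] by (simp_all add: eval_nat_numeral)
  then obtain S4 where S4: "as_long_as_possible (move_Ib n) S3 S4"
    using phase_Ib_exists by blast
  have 4: "reduction_invariant K f n S4" "no_reversals_below (n + 3) S4"
    using phase_Ib[OF 3 S4] by simp_all
  obtain S5 where S5: "move_III n S4 S5"
    by (simp add: move_III_def)
  have 5: "reduction_invariant K f n S5" "levelled n S5"
    using phase_III[OF 4 _ S5] S4 unfolding as_long_as_possible_def by blast+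
  then obtain S6 where S6: "as_long_as_possible (move_IV n) S5 S6"
    using phase_IV_exists by blast
  then obtain T where "remove_all n S6 T"
    using phase_II_exists[OF phase_IV[OF 5 S6]] unfolding as_long_as_possible_def by blast
  then show ?thesis
    using S1 S2 S3 S4 S5 S6 unfolding stage_def by blast
qed

text \<open>
  Needed to see that the recorded moves, counted over all stages, are those recorded at one late stage.
\<close>

definition records_extend :: "'a reduction_state \<Rightarrow> 'a reduction_state \<Rightarrow> bool" where
  "records_extend S T \<longleftrightarrow> blocks S \<subseteq> blocks T \<and> removed S \<subseteq> removed T"

lemma rtranclp_records_extend:
  assumes "\<And>S T. r S T \<Longrightarrow> records_extend S T" "r\<^sup>*\<^sup>* S T"
  shows "records_extend S T"
  using assms(2)
proof induction
  case base
  show ?case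
    by (simp add: records_extend_def)
next
  case (step T U)
  then show ?case
    using assms(1)[OF step.hyps(2)] by (auto simp: records_extend_def)
qed

lemma stage_records_extend:
  assumes "stage n S T"
  shows "records_extend S T"
proof -
  have trans [trans]: "records_extend S U" if "records_extend S T" "records_extend T U"
    for S T U :: "'a reduction_state"
    using that by (auto simp: records_extend_def)
  have alap: "records_extend S T"
    if "as_long_as_possible r S T" "\<And>S T. r S T \<Longrightarrow> records_extend S T"
    for r and S T :: "'a reduction_state"
    using that rtranclp_records_extend unfolding as_long_as_possible_def by blast
  have Ia: "\<And>j S T. move_Ia j S T \<Longrightarrow> records_extend S T"
    and Ib: "\<And>S T. move_Ib n S T \<Longrightarrow> records_extend S T"
    and III: "\<And>S T. move_III n S T \<Longrightarrow> records_extend S T"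
    and IV: "\<And>S T. move_IV n S T \<Longrightarrow> records_extend S T"
    and II: "\<And>S T. move_II n S T \<Longrightarrow> records_extend S T"
    by (auto simp: move_Ia_def move_Ib_def move_III_def move_IV_def move_II_def records_extend_def)
  obtain S1 S2 S3 S4 S5 S6 where
    st: "as_long_as_possible (move_Ia n) S S1" "as_long_as_possible (move_Ia (n + 1)) S1 S2"
    "as_long_as_possible (move_Ia (n + 2)) S2 S3" "as_long_as_possible (move_Ib n) S3 S4"
    "move_III n S4 S5" "as_long_as_possible (move_IV n) S5 S6" "remove_all n S6 T"
    using assms unfolding stage_def by blast
  have "records_extend S S1"
    by (rule alap[OF st(1) Ia])
  also have "records_extend S1 S2"
    by (rule alap[OF st(2) Ia])
  also have "records_extend S2 S3"
    by (rule alap[OF st(3) Ia])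
  also have "records_extend S3 S4"
    by (rule alap[OF st(4) Ib])
  also have "records_extend S4 S5"
    by (rule III[OF st(5)])
  also have "records_extend S5 S6"
    by (rule alap[OF st(6) IV])
  also have "records_extend S6 T"
    using st(7) rtranclp_records_extend[OF II] unfolding remove_all_def by blast
  finally show ?thesis .
qed

context morse_bott
begin

lemma reduction_invariant_start:
  "reduction_invariant K f 0
     \<lparr>current = K, func = f, aside = empty_complex, blocks = {}, removed = {}\<rparr>"
  using morse_bott_axioms by (simp add: reduction_invariant_def)

lemma block_reduction_exists: "\<exists>S. block_reduction K f S"
proof -
  let ?S0 = "\<lparr>current = K, func = f, aside = empty_complex, blocks = {}, removed = {}\<rparr>"
  \<comment> \<open>the start is part of the property carried along, as the choice principle does not fix it\<close>
  have "\<exists>S. \<forall>n. (reduction_invariant K f n (S n) \<and> (n = 0 \<longrightarrow> S n = ?S0)) \<and> stage n (S n) (S (Suc n))"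
  proof (rule dependent_nat_choice)
    show "\<exists>S. reduction_invariant K f 0 S \<and> (0 = 0 \<longrightarrow> S = ?S0)"
      using reduction_invariant_start by blast
    show "\<exists>T. (reduction_invariant K f (Suc n) T \<and> (Suc n = 0 \<longrightarrow> T = ?S0)) \<and> stage n S T"
      if "reduction_invariant K f n S \<and> (n = 0 \<longrightarrow> S = ?S0)" for S n
      using that stage_exists stage_step by blast
  qed
  then show ?thesis
    unfolding block_reduction_def by blast
qed

lemma block_reduction_invariant:
  assumes "block_reduction K f S"
  shows "reduction_invariant K f n (S n)"
proof (induction n)
  case 0
  then show ?case
    using assms reduction_invariant_start by (simp add: block_reduction_def)
next
  case (Suc n)
  then show ?case
    using assms stage_step[OF Suc] by (simp add: block_reduction_def)
qed

text \<open>
  All three parts of the excess vanish, the second one because a cell of dimension \<open>k + 1\<close> has no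
  incidences downwards.
\<close>

lemma no_cells_counts:
  assumes "\<And>\<sigma>. \<sigma> \<in> cells K \<Longrightarrow> k < cdim K \<sigma>"
  shows "excess K f k = 0" "betti K k = 0"
proof -
  have none: "kcells K k = {}"
    using assms by (force simp: kcells_def)
  then show "betti K k = 0"
    using betti_eq[of k] by simp
  have "boundary_rank L (Suc k) = 0" if "lefschetz_complex L" "kcells L k = {}" for L :: "'a lefschetz"
  proof -
    interpret L: lefschetz_complex L by fact
    show ?thesis
      using L.betti_eq[of k] that(2) by simp
  qed
  moreover have "kcells W k = {}"
    using kcells_weakly_critical_complex[of K f k] none by simp
  moreover have "{\<sigma> \<in> kcells K (Suc k). D_snc K f \<sigma> = 1} = {}"
  proof -
    have "D_snc K f \<sigma> = 0" if "\<sigma> \<in> kcells K (Suc k)" for \<sigma>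
    proof -
      have "inc K \<sigma> \<nu> = 0" if "\<nu> \<in> cells K" for \<nu>
        using inc_nonzero_dim[of \<sigma> \<nu>] assms[of \<nu>] that \<open>\<sigma> \<in> kcells K (Suc k)\<close>
        by (auto simp: mem_kcells)
      then have "down_cells K f \<sigma> = {}"
        by (auto simp: down_cells_def)
      then show ?thesis
        by (simp add: D_snc_def)
    qed
    then show ?thesis
      by auto
  qed
  then have "d_snc K f (Suc k) = 0"
    by (simp only: d_snc_def card.empty)
  ultimately show "excess K f k = 0"
    using excess_eq[of k] lefschetz_W lefschetz_complex_axioms none by simp
qed

end

lemma finite_card_Union_stationary:
  fixes A :: "nat \<Rightarrow> 'b set"
  assumes "mono A" "\<And>n. finite (A n)" "\<And>n. m \<le> n \<Longrightarrow> card (A n) = c"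
  shows "finite (\<Union>n. A n)" "card (\<Union>n. A n) = c"
proof -
  have "A n \<subseteq> A m" for n
  proof (cases "n \<le> m")
    case True
    then show ?thesis
      using assms(1) by (simp add: monoD)
  next
    case False
    then have "A m \<subseteq> A n" "card (A m) = card (A n)"
      using assms(1,3) by (simp_all add: monoD)
    then show ?thesis
      using card_subset_eq[OF assms(2)] by blast
  qed
  then have "(\<Union>n. A n) = A m"
    by blast
  then show "finite (\<Union>n. A n)" "card (\<Union>n. A n) = c"
    using assms(2,3) by auto
qed

context morse_bott
begin

text \<open>
  From stage \<open>k + 1\<close> on the current complex has no cells of dimension at most \<open>k\<close>, and the
  conservation laws equate the counts with the excess and the Betti number of \<open>K\<close>.
\<close>

lemma block_reduction_counts:
  assumes run: "block_reduction K f S"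
  shows "finite (produced_blocks K S (Suc k))" "int (card (produced_blocks K S (Suc k))) = excess K f k"
    and "finite (removed_cells K S k)" "card (removed_cells K S k) = betti K k"
proof -
  let ?B = "\<lambda>n. {p \<in> blocks (S n). cdim K (fst p) = Suc k}"
  let ?R = "\<lambda>n. {\<eta> \<in> removed (S n). cdim K \<eta> = k}"
  have inv: "reduction_invariant K f n (S n)" for n
    by (rule block_reduction_invariant[OF run])
  have ext: "records_extend (S n) (S (Suc n))" for n
    using run stage_records_extend unfolding block_reduction_def by blast
  have mono: "mono ?B" "mono ?R"
    using ext unfolding records_extend_def by (intro incseq_SucI; blast)+
  have fin: "finite (?B n)" "finite (?R n)" for n
    using inv[of n] by (auto simp: reduction_invariant_def)
  have zero: "excess (current (S n)) (func (S n)) k = 0" "betti (current (S n)) k = 0"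
    if "Suc k \<le> n" for n
  proof -
    interpret M: morse_bott "current (S n)" "func (S n)"
      using inv[of n] by (simp add: reduction_invariant_def)
    have "k < cdim (current (S n)) \<sigma>" if "\<sigma> \<in> cells (current (S n))" for \<sigma>
      using inv[of n] that \<open>Suc k \<le> n\<close> by (force simp: reduction_invariant_def)
    then show "excess (current (S n)) (func (S n)) k = 0" "betti (current (S n)) k = 0"
      using M.no_cells_counts by blast+
  qed
  have count: "int (card (?B n)) = excess K f k" "card (?R n) = betti K k" if "Suc k \<le> n" for n
  proof -
    have "excess (current (S n)) (func (S n)) k + int (card (?B n)) = excess K f k"
      "betti (current (S n)) k + card (?R n) = betti K k"
      using inv[of n] unfolding reduction_invariant_def by blast+
    then show "int (card (?B n)) = excess K f k" "card (?R n) = betti K k"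
      using zero[OF that] by simp_all
  qed
  have B: "card (?B n) = nat (excess K f k)" if "Suc k \<le> n" for n
    using count(1)[OF that] by linarith
  have PB: "produced_blocks K S (Suc k) = (\<Union>n. ?B n)" and RC: "removed_cells K S k = (\<Union>n. ?R n)"
    by (auto simp: produced_blocks_def removed_cells_def)
  show "finite (produced_blocks K S (Suc k))"
    unfolding PB by (rule finite_card_Union_stationary(1)[OF mono(1) fin(1) B])
  have "card (produced_blocks K S (Suc k)) = nat (excess K f k)"
    unfolding PB by (rule finite_card_Union_stationary(2)[OF mono(1) fin(1) B])
  then show "int (card (produced_blocks K S (Suc k))) = excess K f k"
    using count(1)[of "Suc k"] by simp
  show "finite (removed_cells K S k)"
    unfolding RC by (rule finite_card_Union_stationary(1)[OF mono(2) fin(2) count(2)])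
  show "card (removed_cells K S k) = betti K k"
    unfolding RC by (rule finite_card_Union_stationary(2)[OF mono(2) fin(2) count(2)])
qed

end

text \<open>
  The coefficients of \<open>R\<^sub>t\<close> count blocks of a run, and independence of the choices follows since neither
  the excess nor the Betti number mentions one.
\<close>

theorem corollary5p18:
  fixes K :: "'a lefschetz" and f :: "'a \<Rightarrow> real"
  assumes "lefschetz_complex K" and "discrete_morse_bott K f"
  shows "(\<forall>S k. block_reduction K f S \<longrightarrow>
            finite (produced_blocks K S (k + 1)) \<and>
            fps_nth (R_series K f) k = real (card (produced_blocks K S (k + 1))) \<and>
            finite (removed_cells K S k) \<and>
            betti K k = card (removed_cells K S k))
       \<and> (\<forall>k. fps_nth (R_series K f) k \<in> \<nat>)
       \<and> (\<forall>S S' k. block_reduction K f S \<longrightarrow> block_reduction K f S' \<longrightarrow>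
            card (produced_blocks K S (k + 1)) = card (produced_blocks K S' (k + 1)) \<and>
            card (removed_cells K S k) = card (removed_cells K S' k))"
proof -
  interpret morse_bott K f
    by (rule morse_bott.intro[OF assms(1) morse_bott_axioms.intro[OF assms(2)]])
  have coeff: "fps_nth (R_series K f) k = real (card (produced_blocks K S (k + 1)))"
    if "block_reduction K f S" for S k
    using block_reduction_counts(2)[OF that, of k, symmetric] by (simp add: R_series_nth)
  obtain S where S: "block_reduction K f S"
    using block_reduction_exists by blast
  have "fps_nth (R_series K f) k \<in> \<nat>" for k
    unfolding coeff[OF S] by (rule of_nat_in_Nats)
  moreover have "card (produced_blocks K S (k + 1)) = card (produced_blocks K S' (k + 1))"
    if "block_reduction K f S" "block_reduction K f S'" for S S' k
    using coeff[OF that(1), of k] coeff[OF that(2), of k] by simp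
  moreover have "card (removed_cells K S k) = card (removed_cells K S' k)"
    if "block_reduction K f S" "block_reduction K f S'" for S S' k
    using block_reduction_counts(4)[OF that(1)] block_reduction_counts(4)[OF that(2)] by simp
  moreover have "finite (produced_blocks K S (k + 1))" "finite (removed_cells K S k)"
    "betti K k = card (removed_cells K S k)" if "block_reduction K f S" for S k
    using block_reduction_counts(1,3,4)[OF that, of k] by simp_all
  ultimately show ?thesis
    using coeff by blast
qed

end
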